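(* Let $I\in\mathbb{S}$ be fixed and let $f\in L^2(\mathbb{R},\mathbb{H})$. Then $$f(y)=2^{-\frac14}\int_{\mathbb{R}^2}e^{2\pi I\omega y}\,\mathcal{V}_\varphi f(x,\omega)\,e^{-\pi(y-x)^2}\,dx\,d\omega,\qquad \forall y\in\mathbb{R}.$$
   Context: $\mathbb{H}$ is the algebra of real quaternions, $\mathbb{S}=\{q\in\mathbb{H}:q^2=-1\}$. $L^2(\mathbb{R},\mathbb{H})$ is the space of square integrable $\mathbb{H}$-valued functions on $\mathbb{R}$ with inner product $\langle f,g\rangle=\int_{\mathbb{R}}\overline{g(t)}f(t)\,dt$. The quaternionic Segal-Bargmann transform with parameter $\nu=2\pi$ is $\mathcal{B}^S_{\mathbb{H}}(f)(q)=\int_{\mathbb{R}}2^{3/4}e^{-\pi(q^2+t^2)+2\pi\sqrt2\,qt}f(t)\,dt$, $q\in\mathbb{H}$. Let $\varphi(t)=2^{1/4}e^{-\pi t^2}$. For $I\in\mathbb{S}$ fixed, the 1D quaternion short-time Fourier transform (QSTFT) of $f\in L^2(\mathbb{R},\mathbb{H})$ with window $\varphi$ is $$\mathcal{V}_\varphi f(x,\omega)=e^{-I\pi x\omega}\,\mathcal{B}^S_{\mathbb{H}}(f)\!\left(\frac{\bar q}{\sqrt2}\right)e^{-\frac{\pi|q|^2}{2}},\qquad q=x+I\omega,\ (x,\omega)\in\mathbb{R}^2.$$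
   Formalization: The formula for all y fails for general f in L² (e.g. f = 1_[0,1], where the integral diverges absolutely); proved instead: inversion in L² norm and weakly for every f, and pointwise where the integral converges absolutely, for a.e. y and at every y where f is continuous. *)

theory Defs
  imports "HOL-Analysis.Analysis"
begin

codatatype quat = Quat (qRe: real) (qI: real) (qJ: real) (qK: real)

lemma quat_eqI: "qRe x = qRe y \<Longrightarrow> qI x = qI y \<Longrightarrow> qJ x = qJ y \<Longrightarrow> qK x = qK y \<Longrightarrow> x = y"
  by (rule quat.expand) simp

lemma quat_eq_iff: "x = y \<longleftrightarrow> qRe x = qRe y \<and> qI x = qI y \<and> qJ x = qJ y \<and> qK x = qK y"
  by (auto intro: quat.expand)

instantiation quat :: ab_group_add
begin

primcorec zero_quat where
  "qRe 0 = 0" | "qI 0 = 0" | "qJ 0 = 0" | "qK 0 = 0"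

primcorec plus_quat where
  "qRe (x + y) = qRe x + qRe y"
| "qI (x + y) = qI x + qI y"
| "qJ (x + y) = qJ x + qJ y"
| "qK (x + y) = qK x + qK y"

primcorec uminus_quat where
  "qRe (- x) = - qRe x"
| "qI (- x) = - qI x"
| "qJ (- x) = - qJ x"
| "qK (- x) = - qK x"

primcorec minus_quat where
  "qRe (x - y) = qRe x - qRe y"
| "qI (x - y) = qI x - qI y"
| "qJ (x - y) = qJ x - qJ y"
| "qK (x - y) = qK x - qK y"

instance
  by standard (simp_all add: quat_eq_iff)

end

instantiation quat :: ring_1
begin

primcorec one_quat where
  "qRe 1 = 1" | "qI 1 = 0" | "qJ 1 = 0" | "qK 1 = 0"

primcorec times_quat where
  "qRe (x * y) = qRe x * qRe y - qI x * qI y - qJ x * qJ y - qK x * qK y"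
| "qI (x * y) = qRe x * qI y + qI x * qRe y + qJ x * qK y - qK x * qJ y"
| "qJ (x * y) = qRe x * qJ y - qI x * qK y + qJ x * qRe y + qK x * qI y"
| "qK (x * y) = qRe x * qK y + qI x * qJ y - qJ x * qI y + qK x * qRe y"

instance
  by standard (simp_all add: quat_eq_iff algebra_simps)

end

instantiation quat :: real_algebra_1
begin

primcorec scaleR_quat where
  "qRe (scaleR r x) = r * qRe x"
| "qI (scaleR r x) = r * qI x"
| "qJ (scaleR r x) = r * qJ x"
| "qK (scaleR r x) = r * qK x"

instance
  by standard (simp_all add: quat_eq_iff algebra_simps)

end

instantiation quat :: real_div_algebra
begin

primcorec inverse_quat where
  "qRe (inverse x) = qRe x / ((qRe x)\<^sup>2 + (qI x)\<^sup>2 + (qJ x)\<^sup>2 + (qK x)\<^sup>2)"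
| "qI (inverse x) = - qI x / ((qRe x)\<^sup>2 + (qI x)\<^sup>2 + (qJ x)\<^sup>2 + (qK x)\<^sup>2)"
| "qJ (inverse x) = - qJ x / ((qRe x)\<^sup>2 + (qI x)\<^sup>2 + (qJ x)\<^sup>2 + (qK x)\<^sup>2)"
| "qK (inverse x) = - qK x / ((qRe x)\<^sup>2 + (qI x)\<^sup>2 + (qJ x)\<^sup>2 + (qK x)\<^sup>2)"

definition "x div y = x * inverse y" for x y :: quat

instance
proof
  fix x y :: quat
  define s where "s = (qRe x)\<^sup>2 + (qI x)\<^sup>2 + (qJ x)\<^sup>2 + (qK x)\<^sup>2"
  assume "x \<noteq> 0"
  then have s: "s \<noteq> 0"
    by (auto simp: s_def quat_eq_iff add_nonneg_eq_0_iff)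
  have inv: "inverse x = (1 / s) *\<^sub>R Quat (qRe x) (- qI x) (- qJ x) (- qK x)"
    by (simp add: quat_eq_iff s_def)
  have "Quat (qRe x) (- qI x) (- qJ x) (- qK x) * x = s *\<^sub>R 1"
       "x * Quat (qRe x) (- qI x) (- qJ x) (- qK x) = s *\<^sub>R 1"
    by (simp_all add: quat_eq_iff s_def power2_eq_square algebra_simps)
  with s show "inverse x * x = 1" "x * inverse x = 1"
    by (simp_all add: inv)
next
  show "x div y = x * inverse y" for x y :: quat
    by (rule divide_quat_def)
  show "inverse (0 :: quat) = 0"
    by (simp add: quat_eq_iff)
qed

end

text \<open>Euler's four-square identity.\<close>

lemma four_squares:
  "(a * e - b * f - c * g - d * h)\<^sup>2 + (a * f + b * e + c * h - d * g)\<^sup>2 +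
   (a * g - b * h + c * e + d * f)\<^sup>2 + (a * h + b * g - c * f + d * e)\<^sup>2 =
   (a\<^sup>2 + b\<^sup>2 + c\<^sup>2 + d\<^sup>2) * (e\<^sup>2 + f\<^sup>2 + g\<^sup>2 + h\<^sup>2)" for a :: real
  by algebra

instantiation quat :: real_normed_div_algebra
begin

definition norm_quat where
  "norm q = sqrt ((qRe q)\<^sup>2 + (qI q)\<^sup>2 + (qJ q)\<^sup>2 + (qK q)\<^sup>2)"

definition "sgn q = q /\<^sub>R norm q" for q :: quat
definition "dist x y = norm (x - y)" for x y :: quat
definition [code del]:
  "(uniformity :: (quat \<times> quat) filter) = (INF e\<in>{0 <..}. principal {(x, y). dist x y < e})"
definition [code del]:
  "open (U :: quat set) \<longleftrightarrow> (\<forall>x\<in>U. eventually (\<lambda>(x', y). x' = x \<longrightarrow> y \<in> U) uniformity)"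

lemma norm_quat_triangle: "norm (x + y) \<le> norm x + norm y" for x y :: quat
proof -
  have *: "norm q = norm ((qRe q, qI q), (qJ q, qK q))" for q :: quat
    by (simp add: norm_quat_def norm_prod_def)
  show ?thesis
    using norm_triangle_ineq[of "((qRe x, qI x), (qJ x, qK x))" "((qRe y, qI y), (qJ y, qK y))"]
    by (simp add: *)
qed

instance
proof
  fix r :: real and x y :: quat and U :: "quat set"
  show "(norm x = 0) = (x = 0)"
    by (auto simp: norm_quat_def quat_eq_iff add_nonneg_eq_0_iff)
  show "norm (x + y) \<le> norm x + norm y"
    by (rule norm_quat_triangle)
  show "norm (r *\<^sub>R x) = \<bar>r\<bar> * norm x"
  proof -
    have "(norm (r *\<^sub>R x))\<^sup>2 = (\<bar>r\<bar> * norm x)\<^sup>2"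
      by (simp add: norm_quat_def power_mult_distrib distrib_left)
    then show ?thesis
      by (rule power2_eq_imp_eq) (simp_all add: norm_quat_def)
  qed
  show "norm (x * y) = norm x * norm y"
  proof -
    have "(norm (x * y))\<^sup>2 = (norm x * norm y)\<^sup>2"
      by (simp add: norm_quat_def power_mult_distrib four_squares)
    then show ?thesis
      by (rule power2_eq_imp_eq) (simp_all add: norm_quat_def)
  qed
qed (rule sgn_quat_def dist_quat_def open_quat_def uniformity_quat_def)+

end

instantiation quat :: real_inner
begin

definition inner_quat where
  "inner x y = qRe x * qRe y + qI x * qI y + qJ x * qJ y + qK x * qK y"

instance
  apply standard
  subgoal by (simp add: inner_quat_def)
  subgoal by (simp add: inner_quat_def algebra_simps)
  subgoal by (simp add: inner_quat_def algebra_simps)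
  subgoal by (simp add: inner_quat_def)
  subgoal by (auto simp: inner_quat_def quat_eq_iff add_nonneg_eq_0_iff)
  subgoal by (simp add: inner_quat_def norm_quat_def power2_eq_square)
  done

end

instantiation quat :: euclidean_space
begin

definition "Basis = {Quat 1 0 0 0, Quat 0 1 0 0, Quat 0 0 1 0, Quat 0 0 0 1}"

instance
proof
  fix x u v :: quat
  show "(\<forall>u\<in>Basis. inner x u = 0) = (x = 0)"
    by (simp add: Basis_quat_def inner_quat_def) (auto intro: quat_eqI)
  assume "u \<in> Basis" "v \<in> Basis"
  then show "inner u v = (if u = v then 1 else 0)"
    unfolding Basis_quat_def by (elim insertE emptyE) (simp_all add: inner_quat_def)
qed (simp_all add: Basis_quat_def)

end

primcorec qcnj :: "quat \<Rightarrow> quat" where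
  "qRe (qcnj q) = qRe q"
| "qI (qcnj q) = - qI q"
| "qJ (qcnj q) = - qJ q"
| "qK (qcnj q) = - qK q"

definition unit_imag_sphere :: "quat set"  (\<open>\<bbbS>\<close>) where
  "\<bbbS> = {q. q\<^sup>2 = -1}"

text \<open>Elements are honest functions; two of them represent the same element of the Hilbert space
  when they agree almost everywhere.\<close>

definition L2_quat :: "(real \<Rightarrow> quat) set" where
  "L2_quat = {f. f \<in> borel_measurable lebesgue \<and> integrable lebesgue (\<lambda>t. (norm (f t))\<^sup>2)}"

definition L2_inner :: "(real \<Rightarrow> quat) \<Rightarrow> (real \<Rightarrow> quat) \<Rightarrow> quat" where
  "L2_inner f g = (LINT t|lebesgue. qcnj (g t) * f t)"

definition L2_norm :: "(real \<Rightarrow> quat) \<Rightarrow> real" where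
  "L2_norm f = sqrt (LINT t|lebesgue. (norm (f t))\<^sup>2)"

definition segal_bargmann :: "(real \<Rightarrow> quat) \<Rightarrow> quat \<Rightarrow> quat" where
  "segal_bargmann f q =
     (LINT t|lebesgue. (2 powr (3/4)) *\<^sub>R
        exp (- pi *\<^sub>R (q\<^sup>2 + of_real (t\<^sup>2)) + (2 * pi * sqrt 2 * t) *\<^sub>R q) * f t)"

text \<open>Short-time Fourier transform with Gaussian window \<open>\<phi>(t) = 2\<^sup>1\<^sup>/\<^sup>4 exp(-\<pi> t\<^sup>2)\<close>, defined through the
  Segal-Bargmann transform with parameter \<open>2\<pi>\<close>; the window does not occur explicitly.
  The slice \<open>x + I\<omega>\<close> depends on \<open>I\<close>, so \<open>I\<close> is an argument.\<close>

definition QSTFT :: "quat \<Rightarrow> (real \<Rightarrow> quat) \<Rightarrow> real \<Rightarrow> real \<Rightarrow> quat" where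
  "QSTFT I f x \<omega> =
     (let q = of_real x + I * of_real \<omega> in
        exp (- (I * of_real (pi * x * \<omega>))) * segal_bargmann f (qcnj q /\<^sub>R sqrt 2)
          * of_real (exp (- (pi * (norm q)\<^sup>2 / 2))))"

definition inversion_integrand ::
    "quat \<Rightarrow> (real \<Rightarrow> quat) \<Rightarrow> real \<Rightarrow> real \<times> real \<Rightarrow> quat" where
  "inversion_integrand I f y = (\<lambda>(x, \<omega>).
     exp (I * of_real (2 * pi * \<omega> * y)) * QSTFT I f x \<omega> * of_real (exp (- (pi * (y - x)\<^sup>2))))"

definition inversion_over ::
    "quat \<Rightarrow> (real \<Rightarrow> quat) \<Rightarrow> (real \<times> real) set \<Rightarrow> real \<Rightarrow> quat" where
  "inversion_over I f K y =
     (2 powr (- 1/4)) *\<^sub>R (LINT p:K|lebesgue. inversion_integrand I f y p)"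

end

theory Submission
  imports Defs "HOL-Probability.Probability" "HOL-Real_Asymp.Real_Asymp"
begin

text \<open>Completing the square turns the quaternionic short-time Fourier transform into
  \<open>2\<^sup>3\<^sup>/\<^sup>4\<close> times the Gabor transform
  \<open>G f (x, w) = \<integral> exp (-2 \<pi> I w t) exp (-\<pi> (t - x)\<^sup>2) f t dt\<close>, in which only the slice
  \<open>\<real> + I \<real>\<close> acts, from the left, on \<open>f\<close>.  Plancherel's theorem in \<open>w\<close>, proved by inserting the cutoff
  \<open>exp (-\<pi> w\<^sup>2 / n\<^sup>2)\<close> and using that Gaussians are an approximate identity, followed by an
  integration over \<open>x\<close>, gives Moyal's identity
  \<open>\<integral>\<integral> cnj (G h) G f = 2\<^sup>-\<^sup>1\<^sup>/\<^sup>2 \<langle>f, h\<rangle>\<close>, which is weak inversion.  Testing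
  \<open>h = f - f\<^sub>K\<close>, with \<open>f\<^sub>K\<close> the inversion integral over \<open>K\<close>, against itself bounds \<open>\<parallel>h\<parallel>\<^sup>2\<close> by a multiple
  of the integral of \<open>|G f|\<^sup>2\<close> outside \<open>K\<close>; hence \<open>L\<^sup>2\<close> convergence, and almost everywhere inversion
  along a subsequence.  At a point of continuity the same Gaussian cutoff yields the value.\<close>

text \<open>Noncommutativity shapes the setup. Fourier kernels lie in one commutative slice and
  stand to the left of the signal. Conjugation moves them to the right, so in
  \<open>qcnj (gabor I h x w) * gabor I f x w\<close> the two kernels meet in the middle and combine
  as complex numbers; with the cutoff inserted, integrating them over \<open>w\<close> leaves a real
  factor, which commutes with everything. The constants balance: the window contributes its squared
  norm \<open>1 / sqrt 2\<close>, the transform carries \<open>2 powr (3/4)\<close>, the formula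
  carries \<open>2 powr (- 1/4)\<close>, and their product is 1. The analytic obstacle is that the
  Fourier transform of a windowed square integrable function need not be integrable in
  \<open>w\<close>. The cutoff makes the exchange with the integration in \<open>t\<close>
  absolutely convergent; it is removed by monotone convergence for norms and by dominated
  convergence for products. Cauchy-Schwarz estimates are replaced by \<open>weighted_AM_GM\<close>,
  whose free weight does the work of an optimal constant. Everything is done for Borel functions and
  \<open>lborel\<close>, where product measures behave well, and is transferred to
  \<open>lebesgue\<close> at the end.\<close>

section \<open>Embedding the complex numbers as a slice of the quaternions\<close>

definition slice :: "quat \<Rightarrow> complex \<Rightarrow> quat" where
  "slice I z = Re z *\<^sub>R 1 + Im z *\<^sub>R I"

text \<open>The vector part of the square is twice the real part times the vector part. A nonzero
  real part would therefore kill the vector part and leave a real number with square -1.\<close>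

lemma unit_imag_sphere_iff:
  "I \<in> \<bbbS> \<longleftrightarrow> qRe I = 0 \<and> (qI I)\<^sup>2 + (qJ I)\<^sup>2 + (qK I)\<^sup>2 = 1"
proof
  assume "I \<in> \<bbbS>"
  then have "I * I = - 1"
    by (simp add: unit_imag_sphere_def power2_eq_square)
  then have *: "qRe I * qRe I - qI I * qI I - qJ I * qJ I - qK I * qK I = -1"
      "qRe I * qI I = 0" "qRe I * qJ I = 0" "qRe I * qK I = 0"
    by (auto simp: quat_eq_iff)
  have "qRe I = 0"
  proof (rule ccontr)
    assume "qRe I \<noteq> 0"
    with * have "qRe I * qRe I = -1" by simp
    moreover have "qRe I * qRe I \<ge> 0" by simp
    ultimately show False by linarith
  qed
  with * show "qRe I = 0 \<and> (qI I)\<^sup>2 + (qJ I)\<^sup>2 + (qK I)\<^sup>2 = 1"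
    by (simp add: power2_eq_square)
next
  assume "qRe I = 0 \<and> (qI I)\<^sup>2 + (qJ I)\<^sup>2 + (qK I)\<^sup>2 = 1"
  then show "I \<in> \<bbbS>"
    by (simp add: unit_imag_sphere_def power2_eq_square quat_eq_iff algebra_simps)
qed

lemma slice_sel:
  "qRe (slice I z) = Re z + Im z * qRe I" "qI (slice I z) = Im z * qI I"
  "qJ (slice I z) = Im z * qJ I" "qK (slice I z) = Im z * qK I"
  by (simp_all add: slice_def)

lemma slice_add: "slice I (z + w) = slice I z + slice I w"
  and slice_minus: "slice I (- z) = - slice I z"
  and slice_scaleR: "slice I (r *\<^sub>R z) = r *\<^sub>R slice I z"
  by (simp_all add: slice_def algebra_simps scaleR_add_left scaleR_diff_left)

lemma slice_of_real [simp]: "slice I (of_real r) = of_real r"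
  by (simp add: slice_def of_real_def)

lemma slice_1 [simp]: "slice I 1 = 1"
  by (simp add: slice_def)

lemma slice_i [simp]: "slice I \<i> = I"
  by (simp add: slice_def)

lemma bounded_linear_slice: "bounded_linear (slice I)"
  unfolding slice_def
  by (intro bounded_linear_add bounded_linear_compose[OF bounded_linear_scaleR_left]
        bounded_linear_Re bounded_linear_Im)

text \<open>With \<open>I * I = -1\<close> the slice is a copy of the complex field. This lets
  identities between exponentials be proved over the complex numbers and then transported.\<close>

lemma slice_mult:
  assumes "I \<in> \<bbbS>"
  shows "slice I (z * w) = slice I z * slice I w"
proof -
  have "I * I = -1"
    using assms by (simp add: unit_imag_sphere_def power2_eq_square)
  then show ?thesis
    by (simp add: slice_def algebra_simps)
qed

lemma slice_power: "I \<in> \<bbbS> \<Longrightarrow> slice I (z ^ n) = slice I z ^ n"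
  by (induction n) (simp_all add: slice_mult)

text \<open>A bounded linear multiplicative map may be applied termwise to the exponential
  series.\<close>

lemma slice_exp:
  assumes "I \<in> \<bbbS>"
  shows "slice I (exp z) = exp (slice I z)"
proof -
  have "(\<lambda>n. slice I (z ^ n /\<^sub>R fact n)) sums slice I (exp z)"
    by (intro bounded_linear.sums[OF bounded_linear_slice] exp_converges)
  moreover have "slice I (z ^ n /\<^sub>R fact n) = slice I z ^ n /\<^sub>R fact n" for n
    using assms by (simp add: slice_scaleR slice_power)
  ultimately have "(\<lambda>n. slice I z ^ n /\<^sub>R fact n) sums slice I (exp z)"
    by simp
  then show ?thesis
    using exp_converges sums_unique2 by blast
qed

lemma norm_slice:
  assumes "I \<in> \<bbbS>"
  shows "norm (slice I z) = norm z"
proof -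
  have *: "(qI I)\<^sup>2 + (qJ I)\<^sup>2 + (qK I)\<^sup>2 = 1" "qRe I = 0"
    using assms by (simp_all add: unit_imag_sphere_iff)
  have "(Re z)\<^sup>2 + (Im z)\<^sup>2 * (qI I)\<^sup>2 + (Im z)\<^sup>2 * (qJ I)\<^sup>2 + (Im z)\<^sup>2 * (qK I)\<^sup>2
     = (Re z)\<^sup>2 + (Im z)\<^sup>2 * ((qI I)\<^sup>2 + (qJ I)\<^sup>2 + (qK I)\<^sup>2)"
    by (simp add: algebra_simps)
  then show ?thesis
    by (simp add: norm_quat_def slice_sel cmod_def power_mult_distrib *)
qed

lemma qcnj_slice: "I \<in> \<bbbS> \<Longrightarrow> qcnj (slice I z) = slice I (cnj z)"
  by (simp add: quat_eq_iff slice_sel unit_imag_sphere_iff)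

lemma qcnj_mult: "qcnj (p * q) = qcnj q * qcnj p"
  by (simp add: quat_eq_iff algebra_simps)

lemma qcnj_scaleR: "qcnj (r *\<^sub>R q) = r *\<^sub>R qcnj q"
  by (simp add: quat_eq_iff)

lemma qcnj_add: "qcnj (p + q) = qcnj p + qcnj q"
  by (simp add: quat_eq_iff)

lemma norm_qcnj [simp]: "norm (qcnj q) = norm q"
  by (simp add: norm_quat_def)

lemma qcnj_mult_self: "qcnj q * q = of_real ((norm q)\<^sup>2)"
  by (simp add: quat_eq_iff norm_quat_def of_real_def) (simp add: power2_eq_square algebra_simps)

lemma bounded_linear_qcnj: "bounded_linear qcnj"
  by (rule bounded_linear_intro[where K = 1]) (simp_all add: qcnj_add qcnj_scaleR)

lemmas continuous_on_slice [continuous_intros] = bounded_linear.continuous_on[OF bounded_linear_slice]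
lemmas continuous_on_qcnj [continuous_intros] = bounded_linear.continuous_on[OF bounded_linear_qcnj]

lemma borel_measurable_slice [measurable]: "slice I \<in> borel_measurable borel"
  by (intro borel_measurable_continuous_onI continuous_intros)

lemma borel_measurable_qcnj [measurable]: "qcnj \<in> borel_measurable borel"
  by (intro borel_measurable_continuous_onI continuous_intros)

lemma borel_measurable_cis [measurable]: "cis \<in> borel_measurable borel"
  by (intro borel_measurable_continuous_onI continuous_intros)

lemma quat_mult_of_real: "q * of_real r = r *\<^sub>R q" "of_real r * q = r *\<^sub>R q" for q :: quat
  by (simp_all add: of_real_def)

section \<open>Borel representatives and Gaussian integrals\<close>

text \<open>Coordinates with respect to \<open>Basis\<close> reduce this to real-valued functions;
  the finitely many exceptional null sets have a null union.\<close>

lemma completion_ex_borel_measurable_euclidean: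
  fixes f :: "'a \<Rightarrow> 'b::euclidean_space"
  assumes f: "f \<in> borel_measurable (completion M)"
  obtains g where "g \<in> borel_measurable M" "AE x in M. f x = g x"
proof -
  have "\<exists>g\<in>borel_measurable M. AE x in M. f x \<bullet> b = g x" for b :: 'b
  proof -
    have "(\<lambda>x. f x \<bullet> b) \<in> borel_measurable (completion M)"
      using f by simp
    from completion_ex_borel_measurable_real[OF this] show ?thesis by blast
  qed
  then obtain G where G: "\<And>b::'b. G b \<in> borel_measurable M" "\<And>b. AE x in M. f x \<bullet> b = G b x"
    by metis
  show ?thesis
  proof
    show "(\<lambda>x. \<Sum>b\<in>Basis. G b x *\<^sub>R b) \<in> borel_measurable M"
      using G(1) by simp
    have "AE x in M. \<forall>b\<in>Basis. f x \<bullet> b = G b x"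
      using G(2) by (intro AE_finite_allI) auto
    then show "AE x in M. f x = (\<Sum>b\<in>Basis. G b x *\<^sub>R b)"
      by eventually_elim (metis (mono_tags, lifting) euclidean_representation sum.cong)
  qed
qed

text \<open>The integrand is \<open>1 / sqrt a\<close> times the normal density with mean
  \<open>m\<close> and variance 1 / (2 pi a).\<close>

lemma has_bochner_integral_gaussian:
  assumes "a > 0"
  shows "has_bochner_integral lborel (\<lambda>t. exp (- (pi * a * (t - m)\<^sup>2))) (1 / sqrt a)"
proof -
  define \<sigma> where "\<sigma> = 1 / sqrt (2 * pi * a)"
  have \<sigma>: "\<sigma> > 0" using assms by (simp add: \<sigma>_def)
  have \<sigma>2: "\<sigma>\<^sup>2 = 1 / (2 * pi * a)"
    using assms by (simp add: \<sigma>_def power_divide)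
  have eq: "exp (- (pi * a * (t - m)\<^sup>2)) = (1 / sqrt a) * normal_density m \<sigma> t" for t
    using assms by (simp add: normal_density_def \<sigma>2 real_sqrt_divide field_simps)
  have "has_bochner_integral lborel (\<lambda>t. (1 / sqrt a) * normal_density m \<sigma> t) ((1 / sqrt a) * 1)"
    using integrable_normal_density[OF \<sigma>, of m] integral_normal_density[OF \<sigma>, of m]
    by (intro has_bochner_integral_mult_right) (simp add: has_bochner_integral_iff)
  then show ?thesis
    unfolding eq by simp
qed

text \<open>After a change of scale this is the characteristic function of the standard normal
  distribution.\<close>

lemma integral_gaussian_cis:
  assumes "a > 0"
  shows "(LINT w|lborel. exp (- (pi * a * w\<^sup>2)) *\<^sub>R cis (2 * pi * w * u))
    = complex_of_real (exp (- (pi * u\<^sup>2 / a)) / sqrt a)"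
proof -
  \<comment> \<open>Substituting \<open>c * w\<close> turns the exponent x^2 / 2 of the standard
    normal density into pi a w^2; the frequency \<open>v\<close> is then forced by
    \<open>v * (c * w) = 2 * pi * w * u\<close>.\<close>
  define c where "c = sqrt (2 * pi * a)"
  have c: "c > 0" "c\<^sup>2 = 2 * pi * a" using assms by (simp_all add: c_def)
  define v where "v = 2 * pi * u / c"
  have v: "v * (c * w) = 2 * pi * w * u" for w
    using c(1) by (simp add: v_def)
  have "v\<^sup>2 = (2 * pi * u)\<^sup>2 / c\<^sup>2" by (simp add: v_def power_divide)
  then have v2: "v\<^sup>2 / 2 = pi * u\<^sup>2 / a"
    using assms unfolding c(2) by (simp add: power2_eq_square)
  have "complex_of_real (exp (- v\<^sup>2 / 2)) = char std_normal_distribution v"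
    by (simp add: char_std_normal_distribution)
  also have "\<dots> = (CLINT x|lborel. std_normal_density x *\<^sub>R cis (v * x))"
    unfolding char_def by (subst integral_density) (auto simp: cis_conv_exp)
  also have "\<dots> = \<bar>c\<bar> *\<^sub>R (CLINT w|lborel. std_normal_density (0 + c * w) *\<^sub>R cis (v * (0 + c * w)))"
    using c(1) by (subst lborel_integral_real_affine[where t = 0 and c = c]) auto
  also have "\<dots> = (c / sqrt (2 * pi)) *\<^sub>R (CLINT w|lborel. exp (- (pi * a * w\<^sup>2)) *\<^sub>R cis (2 * pi * w * u))"
  proof -
    have "std_normal_density (0 + c * w) *\<^sub>R cis (v * (0 + c * w))
        = (1 / sqrt (2 * pi)) *\<^sub>R (exp (- (pi * a * w\<^sup>2)) *\<^sub>R cis (2 * pi * w * u))" for w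
      by (simp add: std_normal_density_def power_mult_distrib c(2) v mult.assoc)
    then show ?thesis
      using c(1) by (simp only: integral_scaleR_right) simp
  qed
  also have "c / sqrt (2 * pi) = sqrt a"
    by (simp add: c_def real_sqrt_mult)
  finally have "complex_of_real (exp (- v\<^sup>2 / 2))
      = sqrt a *\<^sub>R (CLINT w|lborel. exp (- (pi * a * w\<^sup>2)) *\<^sub>R cis (2 * pi * w * u))" .
  then have "(1 / sqrt a) *\<^sub>R complex_of_real (exp (- v\<^sup>2 / 2))
      = (CLINT w|lborel. exp (- (pi * a * w\<^sup>2)) *\<^sub>R cis (2 * pi * w * u))"
    using assms by simp
  then show ?thesis
    by (simp add: v2 scaleR_conv_of_real)
qed

section \<open>Square integrable Borel functions\<close>

text \<open>Borel counterpart of \<open>L2_quat\<close>: product measurability and Fubini for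
  \<open>lborel\<close> then apply directly.\<close>

definition borel_L2 :: "(real \<Rightarrow> quat) \<Rightarrow> bool" where
  "borel_L2 f \<longleftrightarrow> f \<in> borel_measurable borel \<and> integrable lborel (\<lambda>t. (norm (f t))\<^sup>2)"

definition L2sq :: "(real \<Rightarrow> quat) \<Rightarrow> real" where
  "L2sq f = (LINT t|lborel. (norm (f t))\<^sup>2)"

lemma borel_L2_measurable: "borel_L2 f \<Longrightarrow> f \<in> borel_measurable borel"
  by (simp add: borel_L2_def)

lemma borel_L2_integrable: "borel_L2 f \<Longrightarrow> integrable lborel (\<lambda>t. (norm (f t))\<^sup>2)"
  by (simp add: borel_L2_def)

lemma L2sq_nonneg: "L2sq f \<ge> 0"
  by (simp add: L2sq_def)

lemma norm_diff_sq_le: "(norm (x - y))\<^sup>2 \<le> 2 * (norm x)\<^sup>2 + 2 * (norm y)\<^sup>2"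
  for x y :: "'a::real_normed_vector"
proof -
  have "(norm (x - y))\<^sup>2 \<le> (norm x + norm y)\<^sup>2"
    by (intro power_mono norm_triangle_ineq4) simp
  also have "\<dots> \<le> 2 * (norm x)\<^sup>2 + 2 * (norm y)\<^sup>2"
    using sum_squares_bound[of "norm x" "norm y"] by (simp add: power2_sum)
  finally show ?thesis .
qed

lemma borel_L2_diff:
  assumes f: "borel_L2 f" and g: "borel_L2 g"
  shows "borel_L2 (\<lambda>t. f t - g t)"
proof -
  note [measurable] = f[THEN borel_L2_measurable] g[THEN borel_L2_measurable]
  have "integrable lborel (\<lambda>t. (norm (f t - g t))\<^sup>2)"
  proof (rule Bochner_Integration.integrable_bound)
    show "integrable lborel (\<lambda>t. 2 * (norm (f t))\<^sup>2 + 2 * (norm (g t))\<^sup>2)"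
      using f g by (simp add: borel_L2_integrable)
  qed (use norm_diff_sq_le in auto)
  then show ?thesis
    by (simp add: borel_L2_def)
qed

text \<open>Stands in for Cauchy-Schwarz. The weight matters when one factor is small and the other
  merely bounded: it can be tuned so that both terms become small.\<close>

lemma weighted_AM_GM: "a > 0 \<Longrightarrow> x * y \<le> (a * x\<^sup>2 + y\<^sup>2 / a) / 2" for x y a :: real
proof -
  assume a: "a > 0"
  have "0 \<le> (a * x - y)\<^sup>2 / a" using a by simp
  also have "\<dots> = a * x\<^sup>2 - 2 * x * y + y\<^sup>2 / a"
    using a by (simp add: power2_eq_square field_simps)
  finally show ?thesis by simp
qed

lemma integrable_L2_mult:
  assumes f: "borel_L2 f" and g: "borel_L2 g"
  shows "integrable lborel (\<lambda>t. qcnj (f t) * g t)"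
    and "a > 0 \<Longrightarrow> norm (LINT t|lborel. qcnj (f t) * g t) \<le> (a * L2sq f + L2sq g / a) / 2"
proof -
  note [measurable] = f[THEN borel_L2_measurable] g[THEN borel_L2_measurable]
  note [simp] = f[THEN borel_L2_integrable] g[THEN borel_L2_integrable]
  have bd: "norm (qcnj (f t) * g t) \<le> (a * (norm (f t))\<^sup>2 + (norm (g t))\<^sup>2 / a) / 2" if "a > 0" for t a
    using weighted_AM_GM[OF that, of "norm (f t)" "norm (g t)"] by (simp add: norm_mult)
  show *: "integrable lborel (\<lambda>t. qcnj (f t) * g t)"
    by (rule Bochner_Integration.integrable_bound[where f = "\<lambda>t. (1 * (norm (f t))\<^sup>2 + (norm (g t))\<^sup>2 / 1) / 2"])
       (use bd[of 1] in auto)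
  assume a: "a > 0"
  have "norm (LINT t|lborel. qcnj (f t) * g t) \<le> (LINT t|lborel. norm (qcnj (f t) * g t))"
    by (rule integral_norm_bound)
  also have "\<dots> \<le> (LINT t|lborel. (a * (norm (f t))\<^sup>2 + (norm (g t))\<^sup>2 / a) / 2)"
    by (rule integral_mono) (use * bd[OF a] in \<open>auto intro!: integrable_norm\<close>)
  also have "\<dots> = (a * L2sq f + L2sq g / a) / 2"
    by (simp add: L2sq_def)
  finally show "norm (LINT t|lborel. qcnj (f t) * g t) \<le> (a * L2sq f + L2sq g / a) / 2" .
qed

subsection \<open>Density of bounded continuous functions\<close>

text \<open>The radial retraction onto the closed ball of radius \<open>m\<close>. Being continuous,
  it bounds an approximating function without spoiling continuity.\<close>

definition clamp_norm :: "real \<Rightarrow> quat \<Rightarrow> quat" where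
  "clamp_norm m q = (m / max m (norm q)) *\<^sub>R q"

lemma norm_clamp_le: "m > 0 \<Longrightarrow> norm (clamp_norm m q) \<le> m"
  and norm_clamp_le_norm: "m > 0 \<Longrightarrow> norm (clamp_norm m q) \<le> norm q"
  and clamp_norm_id: "m > 0 \<Longrightarrow> norm q \<le> m \<Longrightarrow> clamp_norm m q = q"
  by (auto simp: clamp_norm_def max_def field_simps mult_left_mono)

lemma continuous_on_clamp: "m > 0 \<Longrightarrow> continuous_on S (clamp_norm m)"
  unfolding clamp_norm_def by (intro continuous_intros) (auto simp: max_def)

text \<open>A measurable function is an almost everywhere limit of continuous functions, but these
  come without any majorant. Clamping their values and multiplying by an integrable Gaussian
  supplies one. So \<open>f\<close> is first replaced by its clamped and damped version
  \<open>F m\<close>, and inside that version by the continuous \<open>g n\<close>.\<close>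

lemma borel_L2_approx_continuous:
  assumes f: "borel_L2 f" and e: "e > 0"
  obtains \<phi> C where "continuous_on UNIV \<phi>" "\<And>t. norm (\<phi> t) \<le> C" "borel_L2 \<phi>"
    "L2sq (\<lambda>t. f t - \<phi> t) < e"
proof -
  note [measurable] = f[THEN borel_L2_measurable]
  have "f \<in> borel_measurable lebesgue"
    by (simp add: measurable_completion)
  then have "f measurable_on UNIV"
    using measurable_on_iff_borel_measurable[of UNIV f] by simp
  then obtain N g where N: "negligible N" and g: "\<And>n::nat. continuous_on UNIV (g n)"
    and lim: "\<And>x. x \<notin> N \<Longrightarrow> (\<lambda>n. g n x) \<longlonglongrightarrow> f x"
    unfolding measurable_on_def by auto
  have [measurable]: "g n \<in> borel_measurable borel" for n
    by (rule borel_measurable_continuous_onI) (rule g)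
  have "AE x in lebesgue. x \<notin> N"
    using N by (intro AE_not_in) (simp add: negligible_iff_null_sets)
  then have "AE x in lebesgue. (\<lambda>n. g n x) \<longlonglongrightarrow> f x"
    by eventually_elim (rule lim)
  then have AE: "AE x in lborel. (\<lambda>n. g n x) \<longlonglongrightarrow> f x"
    by (simp add: AE_completion_iff)
  \<comment> \<open>A Gaussian that widens with \<open>m\<close>: integrable for each
    \<open>m\<close>, yet tending to 1 pointwise. Since it is at most 1, its square is again below
    the integrable \<open>W m\<close>, which gives the majorant for squared norms.\<close>
  define W where "W m t = exp (- (pi * (1 / real (Suc m)) * (t - 0)\<^sup>2))" for m t
  have W: "0 < W m t" "W m t \<le> 1" for m t
    by (auto simp: W_def)
  have W2: "(W m t)\<^sup>2 \<le> W m t" for m t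
    using W[of m t] by (simp add: power2_eq_square mult_left_le)
  have [measurable]: "W m \<in> borel_measurable borel" for m
    by (simp add: W_def[abs_def])
  have Wint: "integrable lborel (W m)" for m
    using has_bochner_integral_gaussian[of "1 / real (Suc m)" 0]
    unfolding W_def[abs_def] by (simp add: has_bochner_integral_iff)
  have Wlim: "(\<lambda>m. W m t) \<longlonglongrightarrow> 1" for t
    unfolding W_def by real_asymp
  define F where "F m t = W m t *\<^sub>R clamp_norm (real (Suc m)) (f t)" for m t
  define \<psi> where "\<psi> m n t = W m t *\<^sub>R clamp_norm (real (Suc m)) (g n t)" for m n t
  have [measurable]: "clamp_norm (real (Suc m)) \<in> borel_measurable borel" for m
    by (intro borel_measurable_continuous_onI continuous_on_clamp) simp
  have [measurable]: "F m \<in> borel_measurable borel" "\<psi> m n \<in> borel_measurable borel" for m n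
    unfolding F_def[abs_def] \<psi>_def[abs_def] by measurable
  have F_le: "norm (F m t) \<le> norm (f t)" for m t
    using mult_mono[OF W(2)[of m t] norm_clamp_le_norm[of "real (Suc m)" "f t"]] W(1)[of m t]
    by (simp add: F_def less_imp_le)
  have bd1: "(norm (f t - F m t))\<^sup>2 \<le> 4 * (norm (f t))\<^sup>2" for m t
    using norm_diff_sq_le[of "f t" "F m t"] power_mono[OF F_le norm_ge_zero, of m t 2] by linarith
  have \<psi>_le: "(norm (\<psi> m n t))\<^sup>2 \<le> W m t * (real (Suc m))\<^sup>2" for m n t
  proof -
    have "(norm (\<psi> m n t))\<^sup>2 = (W m t)\<^sup>2 * (norm (clamp_norm (real (Suc m)) (g n t)))\<^sup>2"
      by (simp add: \<psi>_def power_mult_distrib)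
    also have "\<dots> \<le> W m t * (real (Suc m))\<^sup>2"
      using W[of m t] W2[of m t] by (intro mult_mono power_mono norm_clamp_le) auto
    finally show ?thesis .
  qed
  have F2_le: "(norm (F m t))\<^sup>2 \<le> W m t * (real (Suc m))\<^sup>2" for m t
  proof -
    have "(norm (F m t))\<^sup>2 = (W m t)\<^sup>2 * (norm (clamp_norm (real (Suc m)) (f t)))\<^sup>2"
      by (simp add: F_def power_mult_distrib)
    also have "\<dots> \<le> W m t * (real (Suc m))\<^sup>2"
      using W[of m t] W2[of m t] by (intro mult_mono power_mono norm_clamp_le) auto
    finally show ?thesis .
  qed
  have F_L2: "borel_L2 (F m)" for m
    unfolding borel_L2_def
    by (intro conjI Bochner_Integration.integrable_bound[OF borel_L2_integrable[OF f]])
       (auto intro!: power_mono F_le)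
  have \<psi>_L2: "borel_L2 (\<psi> m n)" for m n
  proof -
    have "integrable lborel (\<lambda>t. (norm (\<psi> m n t))\<^sup>2)"
    proof (rule Bochner_Integration.integrable_bound)
      show "integrable lborel (\<lambda>t. W m t * (real (Suc m))\<^sup>2)"
        by (intro integrable_mult_left Wint)
      show "AE t in lborel. norm ((norm (\<psi> m n t))\<^sup>2) \<le> norm (W m t * (real (Suc m))\<^sup>2)"
      proof (rule AE_I2)
        fix t
        have "0 \<le> W m t * (real (Suc m))\<^sup>2"
          by (intro mult_nonneg_nonneg less_imp_le[OF W(1)]) simp
        then show "norm ((norm (\<psi> m n t))\<^sup>2) \<le> norm (W m t * (real (Suc m))\<^sup>2)"
          using \<psi>_le[of m n t] by (simp only: real_norm_def abs_of_nonneg zero_le_power2)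
      qed
    qed measurable
    then show ?thesis
      by (simp add: borel_L2_def)
  qed
  have F_lim: "(\<lambda>m. F m t) \<longlonglongrightarrow> f t" for t
  proof -
    have "eventually (\<lambda>m. real m \<ge> norm (f t)) sequentially"
      using filterlim_real_sequentially by (simp add: filterlim_at_top)
    then have "eventually (\<lambda>m. F m t = W m t *\<^sub>R f t) sequentially"
      by eventually_elim (simp add: F_def clamp_norm_id)
    moreover have "(\<lambda>m. W m t *\<^sub>R f t) \<longlonglongrightarrow> 1 *\<^sub>R f t"
      by (intro tendsto_intros Wlim)
    ultimately show ?thesis
      by (simp add: filterlim_cong)
  qed
  have "(\<lambda>m. L2sq (\<lambda>t. f t - F m t)) \<longlonglongrightarrow> (LINT t::real|lborel. (0::real))"
    unfolding L2sq_def
  proof (rule integral_dominated_convergence)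
    show "integrable lborel (\<lambda>t. 4 * (norm (f t))\<^sup>2)"
      using f by (simp add: borel_L2_integrable)
    have "(\<lambda>m. (norm (f t - F m t))\<^sup>2) \<longlonglongrightarrow> (norm (f t - f t))\<^sup>2" for t
      by (intro tendsto_intros F_lim)
    then show "AE t in lborel. (\<lambda>m. (norm (f t - F m t))\<^sup>2) \<longlonglongrightarrow> 0"
      by simp
  qed (use bd1 in auto)
  \<comment> \<open>The threshold is a quarter of \<open>e\<close> because the squared triangle
    inequality doubles each of the two errors.\<close>
  then have "eventually (\<lambda>m. L2sq (\<lambda>t. f t - F m t) < e / 4) sequentially"
    using e by (intro order_tendstoD(2)[where y = 0]) auto
  then obtain m where m: "L2sq (\<lambda>t. f t - F m t) < e / 4"
    using eventually_happens'[OF sequentially_bot] by blast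
  have "(\<lambda>n. L2sq (\<lambda>t. F m t - \<psi> m n t)) \<longlonglongrightarrow> (LINT t::real|lborel. (0::real))"
    unfolding L2sq_def
  proof (rule integral_dominated_convergence)
    show "integrable lborel (\<lambda>t. 4 * (W m t * (real (Suc m))\<^sup>2))"
      using Wint by simp
    show "AE t in lborel. (\<lambda>n. (norm (F m t - \<psi> m n t))\<^sup>2) \<longlonglongrightarrow> 0"
      using AE
    proof eventually_elim
      case (elim t)
      have "isCont (clamp_norm (real (Suc m))) (f t)"
        using continuous_on_clamp[of "real (Suc m)" UNIV] by (simp add: continuous_on_eq_continuous_at)
      then have "(\<lambda>n. clamp_norm (real (Suc m)) (g n t)) \<longlonglongrightarrow> clamp_norm (real (Suc m)) (f t)"
        using elim by (rule isCont_tendsto_compose)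
      then have "(\<lambda>n. (norm (F m t - \<psi> m n t))\<^sup>2) \<longlonglongrightarrow> (norm (F m t - F m t))\<^sup>2"
        unfolding \<psi>_def F_def[of m t] by (intro tendsto_intros)
      then show ?case by simp
    qed
    show "AE t in lborel. norm ((norm (F m t - \<psi> m n t))\<^sup>2) \<le> 4 * (W m t * (real (Suc m))\<^sup>2)" for n
    proof (rule AE_I2)
      fix t
      show "norm ((norm (F m t - \<psi> m n t))\<^sup>2) \<le> 4 * (W m t * (real (Suc m))\<^sup>2)"
        using norm_diff_sq_le[of "F m t" "\<psi> m n t"] F2_le[of m t] \<psi>_le[of m n t] by simp
    qed
  qed auto
  then have "eventually (\<lambda>n. L2sq (\<lambda>t. F m t - \<psi> m n t) < e / 4) sequentially"
    using e by (intro order_tendstoD(2)[where y = 0]) auto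
  then obtain n where n: "L2sq (\<lambda>t. F m t - \<psi> m n t) < e / 4"
    using eventually_happens'[OF sequentially_bot] by blast
  have "L2sq (\<lambda>t. f t - \<psi> m n t) \<le> (LINT t|lborel. 2 * (norm (f t - F m t))\<^sup>2 + 2 * (norm (F m t - \<psi> m n t))\<^sup>2)"
    unfolding L2sq_def
  proof (rule integral_mono)
    show "integrable lborel (\<lambda>t. (norm (f t - \<psi> m n t))\<^sup>2)"
      by (intro borel_L2_integrable borel_L2_diff f \<psi>_L2)
    show "integrable lborel (\<lambda>t. 2 * (norm (f t - F m t))\<^sup>2 + 2 * (norm (F m t - \<psi> m n t))\<^sup>2)"
      using borel_L2_integrable[OF borel_L2_diff[OF f F_L2]] borel_L2_integrable[OF borel_L2_diff[OF F_L2 \<psi>_L2]]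
      by simp
    show "(norm (f t - \<psi> m n t))\<^sup>2 \<le> 2 * (norm (f t - F m t))\<^sup>2 + 2 * (norm (F m t - \<psi> m n t))\<^sup>2" for t
      using norm_diff_sq_le[of "f t - F m t" "\<psi> m n t - F m t"] by (simp add: norm_minus_commute)
  qed
  also have "\<dots> = 2 * L2sq (\<lambda>t. f t - F m t) + 2 * L2sq (\<lambda>t. F m t - \<psi> m n t)"
    using borel_L2_integrable[OF borel_L2_diff[OF f F_L2]] borel_L2_integrable[OF borel_L2_diff[OF F_L2 \<psi>_L2]]
    by (simp add: L2sq_def)
  also have "\<dots> < e" using m n by simp
  finally have "L2sq (\<lambda>t. f t - \<psi> m n t) < e" .
  moreover have "continuous_on UNIV (\<psi> m n)"
    unfolding \<psi>_def[abs_def] W_def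
    by (intro continuous_intros continuous_on_compose2[OF continuous_on_clamp g]) auto
  moreover have "norm (\<psi> m n t) \<le> real (Suc m)" for t
    using mult_mono[OF W(2)[of m t] norm_clamp_le[of "real (Suc m)" "g n t"]] W(1)[of m t]
    by (simp add: \<psi>_def less_imp_le)
  ultimately show ?thesis
    using \<psi>_L2 that by blast
qed

subsection \<open>The Gaussian approximate identity\<close>

text \<open>The centred normal density with standard deviation 1 / (N sqrt (2 pi)), where N =
  \<open>Suc n\<close>; it is also the Fourier transform of the cutoff
  \<open>gcut n\<close>.\<close>

definition gker :: "nat \<Rightarrow> real \<Rightarrow> real" where
  "gker n u = real (Suc n) * exp (- (pi * (real (Suc n))\<^sup>2 * u\<^sup>2))"

lemma gker_nonneg [simp]: "gker n u \<ge> 0"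
  by (simp add: gker_def)

lemma gker_commute: "gker n (s - t) = gker n (t - s)"
  by (simp add: gker_def power2_commute)

lemma borel_measurable_gker [measurable]: "gker n \<in> borel_measurable borel"
  unfolding gker_def[abs_def] by measurable

lemma integrable_gker: "integrable lborel (\<lambda>t. gker n (t - s))"
  and integral_gker: "(LINT t|lborel. gker n (t - s)) = 1"
proof -
  have "has_bochner_integral lborel (\<lambda>t. real (Suc n) * exp (- (pi * (real (Suc n))\<^sup>2 * (t - s)\<^sup>2)))
      (real (Suc n) * (1 / sqrt ((real (Suc n))\<^sup>2)))"
    by (intro has_bochner_integral_mult_right has_bochner_integral_gaussian) simp
  then show "integrable lborel (\<lambda>t. gker n (t - s))" "(LINT t|lborel. gker n (t - s)) = 1"
    by (simp_all add: gker_def has_bochner_integral_iff)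
qed

text \<open>The limit condition on \<open>f\<close> at \<open>y\<close> is only required almost everywhere, so that it survives
  replacing \<open>f\<close> by a Borel representative.\<close>

lemma gker_approx_identity:
  fixes f :: "real \<Rightarrow> quat"
  assumes [measurable]: "f \<in> borel_measurable borel"
    and int: "integrable lborel (\<lambda>t. exp (- (pi * (t - y)\<^sup>2)) *\<^sub>R f t)"
    and lim: "\<And>e. e > 0 \<Longrightarrow> \<exists>d>0. AE t in lborel. \<bar>t - y\<bar> < d \<longrightarrow> norm (f t - L) \<le> e"
  shows "(\<lambda>n. LINT t|lborel. gker n (t - y) *\<^sub>R f t) \<longlonglongrightarrow> L"
proof -
  \<comment> \<open>This is \<open>gker 0\<close> centred at \<open>y\<close>. Since
    \<open>f\<close> itself need not be integrable, all errors are measured against this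
    weight.\<close>
  define w where "w t = exp (- (pi * (t - y)\<^sup>2))" for t
  have w: "has_bochner_integral lborel w 1"
    using has_bochner_integral_gaussian[of 1 y] by (simp add: w_def[abs_def])
  have [measurable]: "w \<in> borel_measurable borel"
    by (simp add: w_def[abs_def])
  have int_g: "integrable lborel (\<lambda>t. w t *\<^sub>R (f t - L))"
    using int w unfolding w_def[symmetric]
    by (auto simp: scaleR_diff_right has_bochner_integral_iff)
  define M where "M = (LINT t|lborel. norm (w t *\<^sub>R (f t - L)))"
  have gw: "gker n (t - y) \<le> real (Suc n) * w t" for n t
  proof -
    have "1 * (t - y)\<^sup>2 \<le> (real (Suc n))\<^sup>2 * (t - y)\<^sup>2"
      by (intro mult_right_mono one_le_power) auto
    then have "pi * (t - y)\<^sup>2 \<le> pi * ((real (Suc n))\<^sup>2 * (t - y)\<^sup>2)"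
      by (intro mult_left_mono) auto
    then show ?thesis
      by (simp add: gker_def w_def mult.assoc del: of_nat_Suc)
  qed
  have int_gk: "integrable lborel (\<lambda>t. gker n (t - y) *\<^sub>R (f t - L))" for n
  proof (rule Bochner_Integration.integrable_bound)
    show "integrable lborel (\<lambda>t. real (Suc n) * norm (w t *\<^sub>R (f t - L)))"
      using int_g by (intro integrable_mult_right integrable_norm)
    show "AE t in lborel. norm (gker n (t - y) *\<^sub>R (f t - L))
        \<le> norm (real (Suc n) * norm (w t *\<^sub>R (f t - L)))"
    proof (rule AE_I2)
      fix t
      have "gker n (t - y) * norm (f t - L) \<le> (real (Suc n) * w t) * norm (f t - L)"
        by (intro mult_right_mono gw) simp
      then show "norm (gker n (t - y) *\<^sub>R (f t - L)) \<le> norm (real (Suc n) * norm (w t *\<^sub>R (f t - L)))"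
        by (simp add: w_def abs_mult mult.assoc)
    qed
  qed simp
  have eq: "(LINT t|lborel. gker n (t - y) *\<^sub>R f t) - L = (LINT t|lborel. gker n (t - y) *\<^sub>R (f t - L))" for n
  proof -
    have "(LINT t|lborel. gker n (t - y) *\<^sub>R f t)
        = (LINT t|lborel. gker n (t - y) *\<^sub>R (f t - L) + gker n (t - y) *\<^sub>R L)"
      by (simp add: scaleR_diff_right)
    also have "\<dots> = (LINT t|lborel. gker n (t - y) *\<^sub>R (f t - L)) + L"
      using int_gk integrable_gker[of n y] integral_gker[of n y] by simp
    finally show ?thesis by simp
  qed
  have "(\<lambda>n. LINT t|lborel. gker n (t - y) *\<^sub>R (f t - L)) \<longlonglongrightarrow> 0"
  proof (rule tendstoI)
    fix e :: real assume e: "e > 0"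
    obtain d where d: "d > 0" and near: "AE t in lborel. \<bar>t - y\<bar> < d \<longrightarrow> norm (f t - L) \<le> e / 2"
      using lim[of "e / 2"] e by auto
    \<comment> \<open>At distance at least \<open>d\<close>, one copy of (t - y)^2 is split off N^2
      (t - y)^2. It keeps the weight \<open>w\<close>, hence integrability, while the remaining N^2
      - 1 copies are at least (N^2 - 1) d^2 and give a factor that vanishes in the limit.\<close>
    define c where "c n = real (Suc n) * exp (- (pi * ((real (Suc n))\<^sup>2 - 1) * d\<^sup>2))" for n
    have "c \<longlonglongrightarrow> 0"
      unfolding c_def using d by real_asymp
    then have "(\<lambda>n. c n * M) \<longlonglongrightarrow> 0"
      by (rule tendsto_mult_left_zero)
    then have ev: "eventually (\<lambda>n. c n * M < e / 2) sequentially"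
      using e by (intro order_tendstoD(2)[where y = 0]) auto
    have far: "gker n (t - y) \<le> c n * w t" if "\<bar>t - y\<bar> \<ge> d" for n t
    proof -
      have "d\<^sup>2 \<le> (t - y)\<^sup>2"
        using that d by (metis abs_le_square_iff abs_of_pos)
      then have "((real (Suc n))\<^sup>2 - 1) * d\<^sup>2 \<le> ((real (Suc n))\<^sup>2 - 1) * (t - y)\<^sup>2"
        by (intro mult_left_mono) (auto simp: power2_eq_square algebra_simps)
      then have "pi * (((real (Suc n))\<^sup>2 - 1) * d\<^sup>2 + (t - y)\<^sup>2) \<le> pi * ((real (Suc n))\<^sup>2 * (t - y)\<^sup>2)"
        by (intro mult_left_mono) (auto simp: algebra_simps)
      then have "exp (- (pi * (real (Suc n))\<^sup>2 * (t - y)\<^sup>2))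
          \<le> exp (- (pi * ((real (Suc n))\<^sup>2 - 1) * d\<^sup>2) + (- (pi * (t - y)\<^sup>2)))"
        by (simp add: algebra_simps del: of_nat_Suc)
      then have "real (Suc n) * exp (- (pi * (real (Suc n))\<^sup>2 * (t - y)\<^sup>2)) \<le> real (Suc n) *
          (exp (- (pi * ((real (Suc n))\<^sup>2 - 1) * d\<^sup>2)) * exp (- (pi * (t - y)\<^sup>2)))"
        unfolding exp_add by (intro mult_left_mono) auto
      then show ?thesis
        by (simp add: gker_def w_def c_def mult.assoc)
    qed
    have bd: "norm (LINT t|lborel. gker n (t - y) *\<^sub>R (f t - L)) \<le> e / 2 + c n * M" for n
    proof -
      have "norm (LINT t|lborel. gker n (t - y) *\<^sub>R (f t - L))
          \<le> (LINT t|lborel. norm (gker n (t - y) *\<^sub>R (f t - L)))"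
        by (rule integral_norm_bound)
      also have "\<dots> \<le> (LINT t|lborel. gker n (t - y) * (e / 2) + c n * norm (w t *\<^sub>R (f t - L)))"
      proof (rule integral_mono_AE)
        show "integrable lborel (\<lambda>t. norm (gker n (t - y) *\<^sub>R (f t - L)))"
          by (intro integrable_norm int_gk)
        show "integrable lborel (\<lambda>t. gker n (t - y) * (e / 2) + c n * norm (w t *\<^sub>R (f t - L)))"
          by (intro Bochner_Integration.integrable_add integrable_mult_left integrable_mult_right
                integrable_gker integrable_norm int_g)
        show "AE t in lborel. norm (gker n (t - y) *\<^sub>R (f t - L))
            \<le> gker n (t - y) * (e / 2) + c n * norm (w t *\<^sub>R (f t - L))"
          using near
        proof eventually_elim
          case (elim t)
          have c0: "c n \<ge> 0" and w0: "w t \<ge> 0" by (simp_all add: c_def w_def)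
          show ?case
          proof (cases "\<bar>t - y\<bar> < d")
            case True
            with elim have "gker n (t - y) * norm (f t - L) \<le> gker n (t - y) * (e / 2)"
              by (intro mult_left_mono) auto
            moreover have "0 \<le> c n * (w t * norm (f t - L))"
              using c0 w0 by simp
            ultimately show ?thesis
              using w0 by simp
          next
            case False
            then have "gker n (t - y) * norm (f t - L) \<le> (c n * w t) * norm (f t - L)"
              by (intro mult_right_mono far) auto
            moreover have "0 \<le> gker n (t - y) * (e / 2)"
              using e by simp
            ultimately show ?thesis
              using w0 by (simp add: mult.assoc)
          qed
        qed
      qed
      also have "\<dots> = e / 2 + c n * M"
        using integrable_norm[OF int_g] by (simp add: integrable_gker integral_gker M_def)
      finally show ?thesis .
    qed
    show "eventually (\<lambda>n. dist (LINT t|lborel. gker n (t - y) *\<^sub>R (f t - L)) 0 < e) sequentially"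
      using ev
    proof eventually_elim
      case (elim n)
      then show ?case using bd[of n] by simp
    qed
  qed
  then show ?thesis
    unfolding eq[symmetric] by (rule LIM_zero_cancel)
qed

lemma integrable_norm_le:
  fixes f :: "'a \<Rightarrow> 'b::{banach, second_countable_topology}" and g :: "'a \<Rightarrow> real"
  assumes "integrable M g" "f \<in> borel_measurable M" "\<And>x. norm (f x) \<le> g x"
  shows "integrable M f"
  by (rule Bochner_Integration.integrable_bound[OF assms(1,2)])
     (auto intro!: AE_I2 order_trans[OF assms(3)])

subsection \<open>Gaussian smoothing of the inner product\<close>

text \<open>The kernel has mass 1 in each variable separately. The second pair of claims follows
  from the first by the symmetry of the kernel.\<close>

lemma integrable_gker_sq:
  assumes "borel_L2 h"
  shows "integrable (lborel \<Otimes>\<^sub>M lborel) (\<lambda>(s, t). gker n (t - s) * (norm (h s))\<^sup>2)"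
    and "integral\<^sup>L (lborel \<Otimes>\<^sub>M lborel) (\<lambda>(s, t). gker n (t - s) * (norm (h s))\<^sup>2) = L2sq h"
    and "integrable (lborel \<Otimes>\<^sub>M lborel) (\<lambda>(s, t). gker n (t - s) * (norm (h t))\<^sup>2)"
    and "integral\<^sup>L (lborel \<Otimes>\<^sub>M lborel) (\<lambda>(s, t). gker n (t - s) * (norm (h t))\<^sup>2) = L2sq h"
proof -
  note [measurable] = assms[THEN borel_L2_measurable]
  show *: "integrable (lborel \<Otimes>\<^sub>M lborel) (\<lambda>(s, t). gker n (t - s) * (norm (h s))\<^sup>2)"
    by (rule lborel_pair.Fubini_integrable)
       (auto simp: abs_mult integral_gker borel_L2_integrable[OF assms] integrable_gker)
  show **: "integral\<^sup>L (lborel \<Otimes>\<^sub>M lborel) (\<lambda>(s, t). gker n (t - s) * (norm (h s))\<^sup>2) = L2sq h"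
    using lborel_pair.integral_fst[OF *] by (simp add: integral_gker L2sq_def)
  show "integrable (lborel \<Otimes>\<^sub>M lborel) (\<lambda>(s, t). gker n (t - s) * (norm (h t))\<^sup>2)"
    using lborel_pair.integrable_product_swap[OF *] by (simp add: gker_commute)
  show "integral\<^sup>L (lborel \<Otimes>\<^sub>M lborel) (\<lambda>(s, t). gker n (t - s) * (norm (h t))\<^sup>2) = L2sq h"
    using lborel_pair.integral_product_swap[of "\<lambda>(s, t). gker n (t - s) * (norm (h s))\<^sup>2"] **
    by (simp add: gker_commute)
qed

text \<open>The inner product of \<open>h\<close> with the convolution of \<open>f\<close> and
  \<open>gker n\<close>. It is the value of the Plancherel integral once the cutoff
  \<open>gcut n\<close> has been inserted.\<close>

definition smoothed_inner :: "nat \<Rightarrow> (real \<Rightarrow> quat) \<Rightarrow> (real \<Rightarrow> quat) \<Rightarrow> quat" where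
  "smoothed_inner n h f = (LINT s|lborel. LINT t|lborel. gker n (t - s) *\<^sub>R (qcnj (h s) * f t))"

text \<open>A Schur test: \<open>weighted_AM_GM\<close> under the integral, together with the unit
  mass of the kernel in both variables. The bound is uniform in \<open>n\<close>, so
  \<open>f\<close> may later be approximated before \<open>n\<close> tends to infinity.\<close>

lemma integrable_gker_mult:
  assumes h: "borel_L2 h" and f: "borel_L2 f"
  shows "integrable (lborel \<Otimes>\<^sub>M lborel) (\<lambda>(s, t). gker n (t - s) *\<^sub>R (qcnj (h s) * f t))"
    and norm_smoothed_inner_le: "a > 0 \<Longrightarrow> norm (smoothed_inner n h f) \<le> (a * L2sq h + L2sq f / a) / 2"
proof -
  note [measurable] = h[THEN borel_L2_measurable] f[THEN borel_L2_measurable]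
  define R where "R a = (\<lambda>p. (a * (case p of (s, t) \<Rightarrow> gker n (t - s) * (norm (h s))\<^sup>2)
      + (case p of (s, t) \<Rightarrow> gker n (t - s) * (norm (f t))\<^sup>2) / a) / 2)" for a
  have R: "integrable (lborel \<Otimes>\<^sub>M lborel) (R a)" for a
    unfolding R_def
    by (intro Bochner_Integration.integrable_add integrable_mult_right integrable_divide_zero
          integrable_gker_sq h f impI)
  have R_int: "integral\<^sup>L (lborel \<Otimes>\<^sub>M lborel) (R a) = (a * L2sq h + L2sq f / a) / 2" for a
    unfolding R_def using integrable_gker_sq[OF h] integrable_gker_sq[OF f] by simp
  have bd: "norm (case p of (s, t) \<Rightarrow> gker n (t - s) *\<^sub>R (qcnj (h s) * f t)) \<le> R a p" if "a > 0" for a p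
  proof -
    obtain s t where p: "p = (s, t)" by (cases p)
    have "gker n (t - s) * (norm (h s) * norm (f t))
        \<le> gker n (t - s) * ((a * (norm (h s))\<^sup>2 + (norm (f t))\<^sup>2 / a) / 2)"
      by (intro mult_left_mono weighted_AM_GM that) simp
    then show ?thesis
      by (simp add: p R_def norm_mult algebra_simps)
  qed
  show *: "integrable (lborel \<Otimes>\<^sub>M lborel) (\<lambda>(s, t). gker n (t - s) *\<^sub>R (qcnj (h s) * f t))"
    by (rule integrable_norm_le[OF R[of 1] _ bd]) auto
  assume a: "a > 0"
  have "norm (smoothed_inner n h f)
      = norm (integral\<^sup>L (lborel \<Otimes>\<^sub>M lborel) (\<lambda>(s, t). gker n (t - s) *\<^sub>R (qcnj (h s) * f t)))"
    using lborel_pair.integral_fst[OF *] by (simp add: smoothed_inner_def)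
  also have "\<dots> \<le> integral\<^sup>L (lborel \<Otimes>\<^sub>M lborel) (\<lambda>p. norm (case p of (s, t) \<Rightarrow> gker n (t - s) *\<^sub>R (qcnj (h s) * f t)))"
    by (rule integral_norm_bound)
  also have "\<dots> \<le> integral\<^sup>L (lborel \<Otimes>\<^sub>M lborel) (R a)"
    by (intro integral_mono integrable_norm * R bd a)
  finally show "norm (smoothed_inner n h f) \<le> (a * L2sq h + L2sq f / a) / 2"
    by (simp add: R_int)
qed

lemma smoothed_inner_diff:
  assumes h: "borel_L2 h" and f: "borel_L2 f" and g: "borel_L2 g"
  shows "smoothed_inner n h (\<lambda>t. f t - g t) = smoothed_inner n h f - smoothed_inner n h g"
proof -
  have *: "smoothed_inner n h f = integral\<^sup>L (lborel \<Otimes>\<^sub>M lborel) (\<lambda>(s, t). gker n (t - s) *\<^sub>R (qcnj (h s) * f t))"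
    if "borel_L2 f" for f
    using lborel_pair.integral_fst[OF integrable_gker_mult(1)[OF h that]] by (simp add: smoothed_inner_def)
  have "(\<lambda>(s, t). gker n (t - s) *\<^sub>R (qcnj (h s) * (f t - g t)))
     = (\<lambda>p. (case p of (s, t) \<Rightarrow> gker n (t - s) *\<^sub>R (qcnj (h s) * f t))
          - (case p of (s, t) \<Rightarrow> gker n (t - s) *\<^sub>R (qcnj (h s) * g t)))"
    by (auto simp: algebra_simps scaleR_diff_right)
  then show ?thesis
    unfolding *[OF f] *[OF g] *[OF borel_L2_diff[OF f g]]
    by (simp only: Bochner_Integration.integral_diff integrable_gker_mult(1)[OF h f]
          integrable_gker_mult(1)[OF h g])
qed

text \<open>Here the convolution converges at every point and stays below \<open>C\<close>, so a
  multiple of the norm of the integrable \<open>h\<close> is a majorant for the outer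
  integral.\<close>

lemma smoothed_inner_tendsto_bounded_continuous:
  assumes h: "borel_L2 h" "integrable lborel h"
    and \<phi>: "continuous_on UNIV \<phi>" and C: "\<And>t. norm (\<phi> t) \<le> C"
  shows "(\<lambda>n. smoothed_inner n h \<phi>) \<longlonglongrightarrow> (LINT t|lborel. qcnj (h t) * \<phi> t)"
proof -
  note [measurable] = h(1)[THEN borel_L2_measurable]
  have [measurable]: "\<phi> \<in> borel_measurable borel"
    by (rule borel_measurable_continuous_onI) (rule \<phi>)
  have int_w: "integrable lborel (\<lambda>t. w t *\<^sub>R \<phi> t)" if "integrable lborel w" for w :: "real \<Rightarrow> real"
  proof (rule integrable_norm_le)
    show "integrable lborel (\<lambda>t. norm (w t) * C)"
      using that by (intro integrable_mult_left integrable_norm)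
    show "norm (w t *\<^sub>R \<phi> t) \<le> norm (w t) * C" for t
      by (simp add: C mult_left_mono)
  qed (use borel_measurable_integrable[OF that] in simp)
  have *: "(\<lambda>n. LINT t|lborel. gker n (t - s) *\<^sub>R \<phi> t) \<longlonglongrightarrow> \<phi> s" for s
  proof (rule gker_approx_identity)
    have "integrable lborel (\<lambda>t. exp (- (pi * (t - s)\<^sup>2)))"
      using has_bochner_integral_gaussian[of 1 s] by (simp add: has_bochner_integral_iff)
    then show "integrable lborel (\<lambda>t. exp (- (pi * (t - s)\<^sup>2)) *\<^sub>R \<phi> t)"
      by (rule int_w)
    fix e :: real assume "e > 0"
    moreover have "isCont \<phi> s"
      using \<phi> by (simp add: continuous_on_eq_continuous_at)
    ultimately obtain d where "d > 0" "\<And>t. dist t s < d \<Longrightarrow> dist (\<phi> t) (\<phi> s) < e"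
      unfolding continuous_at_eps_delta by blast
    then show "\<exists>d>0. AE t in lborel. \<bar>t - s\<bar> < d \<longrightarrow> norm (\<phi> t - \<phi> s) \<le> e"
      by (intro exI[of _ d]) (auto simp: dist_norm less_imp_le)
  qed simp
  have eq: "smoothed_inner n h \<phi> = (LINT s|lborel. qcnj (h s) * (LINT t|lborel. gker n (t - s) *\<^sub>R \<phi> t))" for n
    
  proof -
    have "(LINT t|lborel. gker n (t - s) *\<^sub>R (q * \<phi> t)) = q * (LINT t|lborel. gker n (t - s) *\<^sub>R \<phi> t)"
      for s and q :: quat
      using int_w[OF integrable_gker[of n s]] by (simp flip: mult_scaleR_right)
    then show ?thesis
      by (simp add: smoothed_inner_def)
  qed
  show ?thesis
    unfolding eq
  proof (rule integral_dominated_convergence)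
    show "integrable lborel (\<lambda>s. norm (h s) * C)"
      using h(2) by simp
    show "AE s in lborel. (\<lambda>n. qcnj (h s) * (LINT t|lborel. gker n (t - s) *\<^sub>R \<phi> t)) \<longlonglongrightarrow> qcnj (h s) * \<phi> s"
      by (intro AE_I2 tendsto_intros *)
    show "AE s in lborel. norm (qcnj (h s) * (LINT t|lborel. gker n (t - s) *\<^sub>R \<phi> t)) \<le> norm (h s) * C" for n
    proof (rule AE_I2)
      fix s
      have "norm (LINT t|lborel. gker n (t - s) *\<^sub>R \<phi> t) \<le> (LINT t|lborel. norm (gker n (t - s) *\<^sub>R \<phi> t))"
        by (rule integral_norm_bound)
      also have "\<dots> \<le> (LINT t|lborel. gker n (t - s) * C)"
        using C by (intro integral_mono integrable_norm int_w integrable_gker integrable_mult_left)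
          (auto intro!: mult_left_mono)
      also have "\<dots> = C" by (simp add: integral_gker)
      finally show "norm (qcnj (h s) * (LINT t|lborel. gker n (t - s) *\<^sub>R \<phi> t)) \<le> norm (h s) * C"
        by (simp add: norm_mult mult_left_mono)
    qed
  qed measurable
qed

text \<open>A three-term estimate: both the smoothed and the plain pairing change little, uniformly
  in \<open>n\<close>, when \<open>f\<close> is replaced by a bounded continuous
  approximation.\<close>

lemma smoothed_inner_tendsto:
  assumes h: "borel_L2 h" "integrable lborel h" and f: "borel_L2 f"
  shows "(\<lambda>n. smoothed_inner n h f) \<longlonglongrightarrow> (LINT t|lborel. qcnj (h t) * f t)"
proof (rule tendstoI)
  fix e :: real assume e: "e > 0"
  \<comment> \<open>The weight is fixed first, so that its product with \<open>L2sq h\<close> is at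
    most a quarter of \<open>e\<close>; the summand 1 covers \<open>L2sq h = 0\<close>. The
    approximation is then chosen close enough to survive division by this weight.\<close>
  define a where "a = e / (4 * (L2sq h + 1))"
  have a: "a > 0"
    using e L2sq_nonneg[of h] by (simp add: a_def)
  have ah: "a * L2sq h \<le> e / 4"
    using e L2sq_nonneg[of h] by (simp add: a_def field_simps)
  obtain \<phi> C where \<phi>: "continuous_on UNIV \<phi>" "\<And>t. norm (\<phi> t) \<le> C" "borel_L2 \<phi>"
    and close: "L2sq (\<lambda>t. f t - \<phi> t) < a * (e / 4)"
    using borel_L2_approx_continuous[OF f, of "a * (e / 4)"] a e by auto
  have cl: "(a * L2sq h + L2sq (\<lambda>t. f t - \<phi> t) / a) / 2 \<le> e / 4"
  proof -
    have "L2sq (\<lambda>t. f t - \<phi> t) / a < e / 4"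
      using close a by (simp add: pos_divide_less_eq mult.commute)
    with ah show ?thesis by argo
  qed
  have D: "borel_L2 (\<lambda>t. f t - \<phi> t)"
    by (intro borel_L2_diff f \<phi>)
  let ?P = "\<lambda>f. LINT t|lborel. qcnj (h t) * f t"
  have "?P (\<lambda>t. f t - \<phi> t) = ?P f - ?P \<phi>"
    using integrable_L2_mult(1)[OF h(1) f] integrable_L2_mult(1)[OF h(1) \<phi>(3)]
    by (simp add: right_diff_distrib)
  then have 1: "norm (?P f - ?P \<phi>) \<le> e / 4"
    using order_trans[OF integrable_L2_mult(2)[OF h(1) D a] cl] by simp
  have 2: "norm (smoothed_inner n h f - smoothed_inner n h \<phi>) \<le> e / 4" for n
    using order_trans[OF norm_smoothed_inner_le[OF h(1) D a] cl]
    by (simp only: smoothed_inner_diff[OF h(1) f \<phi>(3)])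
  have "eventually (\<lambda>n. dist (smoothed_inner n h \<phi>) (?P \<phi>) < e / 4) sequentially"
    using e by (intro tendstoD[OF smoothed_inner_tendsto_bounded_continuous[OF h \<phi>(1,2)]]) auto
  then show "eventually (\<lambda>n. dist (smoothed_inner n h f) (?P f) < e) sequentially"
  proof eventually_elim
    case (elim n)
    have "norm (smoothed_inner n h f - ?P f) \<le> norm (smoothed_inner n h f - smoothed_inner n h \<phi>)
        + norm (smoothed_inner n h \<phi> - ?P \<phi>) + norm (?P f - ?P \<phi>)"
      using norm_triangle_ineq[of "smoothed_inner n h f - smoothed_inner n h \<phi>" "smoothed_inner n h \<phi> - ?P f"]
        norm_triangle_ineq4[of "smoothed_inner n h \<phi> - ?P \<phi>" "?P f - ?P \<phi>"] by simp
    then show ?case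
      using 1 2[of n] elim e by (simp add: dist_norm)
  qed
qed

subsection \<open>Plancherel's theorem\<close>

lemma lborel_product_integral:
  fixes f :: "'a::euclidean_space \<Rightarrow> 'c::{banach, second_countable_topology, real_normed_div_algebra}"
    and g :: "'b::euclidean_space \<Rightarrow> 'c"
  assumes f: "integrable lborel f" and g: "integrable lborel g"
  shows "integrable (lborel \<Otimes>\<^sub>M lborel) (\<lambda>(x, y). f x * g y)"
    and "integral\<^sup>L (lborel \<Otimes>\<^sub>M lborel) (\<lambda>(x, y). f x * g y) = integral\<^sup>L lborel f * integral\<^sup>L lborel g"
proof -
  have [measurable]: "f \<in> borel_measurable borel" "g \<in> borel_measurable borel"
    using borel_measurable_integrable[OF f] borel_measurable_integrable[OF g] by simp_all
  show *: "integrable (lborel \<Otimes>\<^sub>M lborel) (\<lambda>(x, y). f x * g y)"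
    by (rule lborel_pair.Fubini_integrable) (auto simp: norm_mult f g)
  show "integral\<^sup>L (lborel \<Otimes>\<^sub>M lborel) (\<lambda>(x, y). f x * g y) = integral\<^sup>L lborel f * integral\<^sup>L lborel g"
    using lborel_pair.integral_fst[OF *] f g by simp
qed

text \<open>The position of the kernel is essential: it stands to the left of \<open>g\<close>, so
  in \<open>qcnj (qft I h w) * qft I g w\<close> the kernels are adjacent and multiply within the
  slice.\<close>

definition qft :: "quat \<Rightarrow> (real \<Rightarrow> quat) \<Rightarrow> real \<Rightarrow> quat" where
  "qft I g w = (LINT t|lborel. slice I (cis (- (2 * pi * w * t))) * g t)"

lemma qft_measurable [measurable]:
  assumes [measurable]: "g \<in> borel_measurable borel"
  shows "qft I g \<in> borel_measurable borel"
  unfolding qft_def[abs_def] by measurable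

lemma integrable_qft:
  assumes I: "I \<in> \<bbbS>" and g: "integrable lborel g"
  shows "integrable lborel (\<lambda>t. slice I (cis (u * t)) * g t)"
    and "integrable lborel (\<lambda>t. g t * slice I (cis (u * t)))"
  using g by (auto intro!: integrable_norm_le[OF integrable_norm[OF g]] simp: norm_mult norm_slice I)

lemma qcnj_qft:
  assumes I: "I \<in> \<bbbS>" and g: "integrable lborel g"
  shows "qcnj (qft I g w) = (LINT t|lborel. qcnj (g t) * slice I (cis (2 * pi * w * t)))"
proof -
  have "qcnj (qft I g w) = (LINT t|lborel. qcnj (slice I (cis (- (2 * pi * w * t))) * g t))"
    unfolding qft_def
    using integrable_qft(1)[OF I g, of "- (2 * pi * w)"]
    by (intro integral_bounded_linear[OF bounded_linear_qcnj, symmetric]) simp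
  then show ?thesis
    by (simp add: qcnj_mult qcnj_slice[OF I] cis_cnj)
qed

text \<open>Its width is reciprocal to that of \<open>gker n\<close>; it increases to 1 with
  \<open>n\<close>, so both monotone and dominated convergence can remove it.\<close>

definition gcut :: "nat \<Rightarrow> real \<Rightarrow> real" where
  "gcut n w = exp (- (pi * (1 / (real (Suc n))\<^sup>2) * w\<^sup>2))"

lemma gcut_bounds: "0 \<le> gcut n w" "gcut n w \<le> 1"
  by (simp_all add: gcut_def)

lemma borel_measurable_gcut [measurable]: "gcut n \<in> borel_measurable borel"
  unfolding gcut_def[abs_def] by measurable

lemma integrable_gcut: "integrable lborel (gcut n)"
  using has_bochner_integral_gaussian[of "1 / (real (Suc n))\<^sup>2" 0]
  by (simp add: gcut_def[abs_def] has_bochner_integral_iff)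

lemma gcut_tendsto: "(\<lambda>n. gcut n w) \<longlonglongrightarrow> 1"
proof -
  have "(\<lambda>n. exp (- (pi * (inverse (real (Suc n)))\<^sup>2 * w\<^sup>2))) \<longlonglongrightarrow> exp (- (pi * 0\<^sup>2 * w\<^sup>2))"
    by (intro tendsto_intros LIMSEQ_inverse_real_of_nat)
  moreover have "exp (- (pi * 0\<^sup>2 * w\<^sup>2)) = 1"
    by simp
  ultimately show ?thesis
    by (simp only: gcut_def inverse_eq_divide power_one_over)
qed

lemma gcut_mono: "m \<le> n \<Longrightarrow> gcut m w \<le> gcut n w"
proof -
  assume "m \<le> n"
  then have "1 / (real (Suc n))\<^sup>2 \<le> 1 / (real (Suc m))\<^sup>2"
    by (intro divide_left_mono power_mono) auto
  then have "pi * (1 / (real (Suc n))\<^sup>2) * w\<^sup>2 \<le> pi * (1 / (real (Suc m))\<^sup>2) * w\<^sup>2"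
    by (intro mult_right_mono mult_left_mono) auto
  then show ?thesis
    by (simp add: gcut_def)
qed

text \<open>Computed over the complex numbers and carried over by the bounded linear map
  \<open>slice I\<close>. The value is real, hence independent of \<open>I\<close> and
  central.\<close>

lemma gcut_fourier:
  shows "integrable lborel (\<lambda>w. gcut n w *\<^sub>R slice I (cis (2 * pi * w * u)))"
    and "(LINT w|lborel. gcut n w *\<^sub>R slice I (cis (2 * pi * w * u))) = of_real (gker n u)"
proof -
  define a where "a = 1 / (real (Suc n))\<^sup>2"
  have a: "a > 0" by (simp add: a_def)
  let ?c = "\<lambda>w. gcut n w *\<^sub>R cis (2 * pi * w * u)"
  have c: "integrable lborel ?c"
    by (rule integrable_norm_le[OF integrable_gcut[of n]]) (auto simp: gcut_bounds)
  show "integrable lborel (\<lambda>w. gcut n w *\<^sub>R slice I (cis (2 * pi * w * u)))"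
    using integrable_bounded_linear[OF bounded_linear_slice[of I] c] by (simp add: slice_scaleR)
  have "(LINT w|lborel. gcut n w *\<^sub>R slice I (cis (2 * pi * w * u))) = (LINT w|lborel. slice I (?c w))"
    by (simp only: slice_scaleR)
  also have "\<dots> = slice I (LINT w|lborel. ?c w)"
    by (rule integral_bounded_linear[OF bounded_linear_slice c])
  also have "(LINT w|lborel. ?c w) = complex_of_real (exp (- (pi * u\<^sup>2 / a)) / sqrt a)"
    unfolding gcut_def a_def[symmetric] by (rule integral_gaussian_cis[OF a])
  also have "exp (- (pi * u\<^sup>2 / a)) / sqrt a = gker n u"
    by (simp add: gker_def a_def real_sqrt_divide mult_ac)
  finally show "(LINT w|lborel. gcut n w *\<^sub>R slice I (cis (2 * pi * w * u))) = of_real (gker n u)"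
    by simp
qed

text \<open>The cutoff makes the triple integral over \<open>w\<close>, \<open>s\<close> and
  \<open>t\<close> absolutely convergent. Integrating over \<open>w\<close> last gives the left
  side, integrating over it first gives the right side.\<close>

lemma integral_gaussian_qft_mult:
  assumes I: "I \<in> \<bbbS>" and h: "borel_L2 h" "integrable lborel h" and g: "borel_L2 g" "integrable lborel g"
  shows "(LINT w|lborel. gcut n w *\<^sub>R (qcnj (qft I h w) * qft I g w)) = smoothed_inner n h g"
proof -
  note [measurable] = h(1)[THEN borel_L2_measurable] g(1)[THEN borel_L2_measurable]
  define \<Phi> where "\<Phi> w p = gcut n w *\<^sub>R (qcnj (h (fst p)) * slice I (cis (2 * pi * w * (fst p - snd p))) * g (snd p))"
    for w and p :: "real \<times> real"
  let ?P = "lborel \<Otimes>\<^sub>M lborel :: (real \<times> real) measure"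
  have hg: "integrable lborel (\<lambda>p. norm (h (fst p)) * norm (g (snd p)))"
    using lborel_product_integral(1)[OF integrable_norm[OF h(2)] integrable_norm[OF g(2)]]
    by (simp add: lborel_prod case_prod_unfold)
  have int: "integrable (lborel \<Otimes>\<^sub>M lborel) (\<lambda>(w, p). \<Phi> w p)"
  proof (rule integrable_norm_le)
    show "integrable (lborel \<Otimes>\<^sub>M lborel) (\<lambda>(w, p). gcut n w * (norm (h (fst p)) * norm (g (snd p))))"
      by (rule lborel_product_integral(1)[OF integrable_gcut hg])
    show "(\<lambda>(w, p). \<Phi> w p) \<in> borel_measurable (lborel \<Otimes>\<^sub>M lborel)"
      unfolding \<Phi>_def lborel_prod[symmetric] by measurable
    show "norm (case x of (w, p) \<Rightarrow> \<Phi> w p) \<le> (case x of (w, p) \<Rightarrow> gcut n w * (norm (h (fst p)) * norm (g (snd p))))" for x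
      by (auto simp: \<Phi>_def norm_mult norm_slice[OF I] gcut_bounds split: prod.split)
  qed
  \<comment> \<open>For fixed \<open>w\<close> the middle kernel splits into a factor in
    \<open>s\<close> beside \<open>qcnj (h s)\<close> and a factor in \<open>t\<close> beside
    \<open>g t\<close>, so the double integral becomes an ordered product.\<close>
  have 1: "(LINT p|lborel. \<Phi> w p) = gcut n w *\<^sub>R (qcnj (qft I h w) * qft I g w)" for w
  proof -
    let ?A = "\<lambda>s. qcnj (h s) * slice I (cis (2 * pi * w * s))"
    let ?B = "\<lambda>t. slice I (cis (- (2 * pi * w * t))) * g t"
    have "integrable lborel (\<lambda>s. qcnj (h s))"
      using integrable_bounded_linear[OF bounded_linear_qcnj h(2)] .
    then have A: "integrable lborel ?A"
      using integrable_qft(2)[OF I, of _ "2 * pi * w"] by simp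
    have B: "integrable lborel ?B"
      using integrable_qft(1)[OF I g(2), of "- (2 * pi * w)"] by simp
    have "\<Phi> w p = gcut n w *\<^sub>R (case p of (s, t) \<Rightarrow> ?A s * ?B t)" for p
    proof -
      have "slice I (cis (2 * pi * w * (fst p - snd p)))
          = slice I (cis (2 * pi * w * fst p)) * slice I (cis (- (2 * pi * w * snd p)))"
        by (simp flip: slice_mult[OF I] add: cis_mult right_diff_distrib)
      then show ?thesis
        by (simp add: \<Phi>_def case_prod_unfold mult.assoc)
    qed
    then have "(LINT p|lborel. \<Phi> w p) = gcut n w *\<^sub>R integral\<^sup>L ?P (\<lambda>(s, t). ?A s * ?B t)"
      by (simp add: lborel_prod)
    also have "\<dots> = gcut n w *\<^sub>R (qcnj (qft I h w) * qft I g w)"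
      unfolding lborel_product_integral(2)[OF A B] qcnj_qft[OF I h(2)] by (simp add: qft_def)
    finally show ?thesis .
  qed
  \<comment> \<open>The kernel is enclosed between two constants that do not commute with it; its
    integral is real and may leave that position.\<close>
  have 2: "(LINT w|lborel. \<Phi> w p) = (case p of (s, t) \<Rightarrow> gker n (t - s) *\<^sub>R (qcnj (h s) * g t))" for p
  proof -
    obtain s t where p: "p = (s, t)" by (cases p)
    let ?c = "\<lambda>w. gcut n w *\<^sub>R slice I (cis (2 * pi * w * (s - t)))"
    have "(LINT w|lborel. \<Phi> w p) = (LINT w|lborel. qcnj (h s) * ?c w * g t)"
      by (simp add: \<Phi>_def p)
    also have "\<dots> = qcnj (h s) * (LINT w|lborel. ?c w) * g t"
      by (simp only: Bochner_Integration.integral_mult_left Bochner_Integration.integral_mult_right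
            integrable_mult_right gcut_fourier(1))
    finally show ?thesis
      by (simp only: gcut_fourier(2) quat_mult_of_real p prod.case gker_commute mult_scaleR_left)
  qed
  have "(LINT w|lborel. gcut n w *\<^sub>R (qcnj (qft I h w) * qft I g w)) = (LINT w|lborel. LINT p|lborel. \<Phi> w p)"
    by (simp only: 1)
  also have "\<dots> = (LINT p|lborel. LINT w|lborel. \<Phi> w p)"
    by (rule lborel_pair.Fubini_integral[OF int, symmetric])
  also have "\<dots> = integral\<^sup>L ?P (\<lambda>(s, t). gker n (t - s) *\<^sub>R (qcnj (h s) * g t))"
    by (simp only: 2 lborel_prod)
  also have "\<dots> = smoothed_inner n h g"
    unfolding smoothed_inner_def
    by (rule lborel_pair.integral_fst[OF integrable_gker_mult(1)[OF h(1) g(1)], symmetric])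
  finally show ?thesis .
qed

text \<open>Regularised Fourier inversion: thanks to the cutoff, Fubini moves the integration in
  \<open>w\<close> onto the kernel alone, where it produces \<open>gker n\<close>.\<close>

lemma qft_multiplication:
  assumes I: "I \<in> \<bbbS>" and g: "integrable lborel g"
  shows "(LINT w|lborel. gcut n w *\<^sub>R (slice I (cis (2 * pi * w * y)) * qft I g w))
    = (LINT t|lborel. gker n (t - y) *\<^sub>R g t)"
proof -
  have [measurable]: "g \<in> borel_measurable borel"
    using borel_measurable_integrable[OF g] by simp
  have int: "integrable (lborel \<Otimes>\<^sub>M lborel)
      (\<lambda>(w, t). gcut n w *\<^sub>R (slice I (cis (2 * pi * w * (y - t))) * g t))"
  proof (rule integrable_norm_le)
    show "integrable (lborel \<Otimes>\<^sub>M lborel) (\<lambda>(w, t). gcut n w * norm (g t))"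
      by (rule lborel_product_integral(1)[OF integrable_gcut integrable_norm[OF g]])
  qed (auto simp: norm_mult norm_slice[OF I] gcut_bounds)
  have 1: "(LINT t|lborel. gcut n w *\<^sub>R (slice I (cis (2 * pi * w * (y - t))) * g t))
      = gcut n w *\<^sub>R (slice I (cis (2 * pi * w * y)) * qft I g w)" for w
  proof -
    have "slice I (cis (2 * pi * w * (y - t))) * g t
        = slice I (cis (2 * pi * w * y)) * (slice I (cis (- (2 * pi * w * t))) * g t)" for t
      by (simp add: cis_mult right_diff_distrib flip: slice_mult[OF I] mult.assoc)
    then show ?thesis
      using integrable_qft(1)[OF I g, of "- (2 * pi * w)"] by (simp add: qft_def)
  qed
  have 2: "(LINT w|lborel. gcut n w *\<^sub>R (slice I (cis (2 * pi * w * (y - t))) * g t)) = gker n (t - y) *\<^sub>R g t" for t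
  proof -
    have "(LINT w|lborel. gcut n w *\<^sub>R (slice I (cis (2 * pi * w * (y - t))) * g t))
        = (LINT w|lborel. (gcut n w *\<^sub>R slice I (cis (2 * pi * w * (y - t)))) * g t)"
      by simp
    also have "\<dots> = (LINT w|lborel. gcut n w *\<^sub>R slice I (cis (2 * pi * w * (y - t)))) * g t"
      by (rule Bochner_Integration.integral_mult_left) (rule gcut_fourier(1))
    finally show ?thesis
      by (simp only: gcut_fourier(2) quat_mult_of_real gker_commute)
  qed
  show ?thesis
    using lborel_pair.Fubini_integral[OF int] unfolding 1 2 by simp
qed

text \<open>Integrability of the squared transform is not known beforehand. The cut-off integrals
  increase with \<open>n\<close> and converge to \<open>L2sq g\<close>, so monotone convergence
  yields integrability and value together.\<close>

lemma plancherel_norm: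
  assumes I: "I \<in> \<bbbS>" and g: "borel_L2 g" "integrable lborel g"
  shows "integrable lborel (\<lambda>w. (norm (qft I g w))\<^sup>2)"
    and "(LINT w|lborel. (norm (qft I g w))\<^sup>2) = L2sq g"
proof -
  note [measurable] = g(1)[THEN borel_L2_measurable]
  have qft_bd: "norm (qft I g w) \<le> (LINT t|lborel. norm (g t))" for w
    unfolding qft_def using integral_norm_bound[of lborel "\<lambda>t. slice I (cis (- (2 * pi * w * t))) * g t"]
    by (simp add: norm_mult norm_slice[OF I])
  have int: "integrable lborel (\<lambda>w. gcut n w * (norm (qft I g w))\<^sup>2)" for n
  proof (rule integrable_norm_le)
    show "integrable lborel (\<lambda>w. gcut n w * (LINT t|lborel. norm (g t))\<^sup>2)"
      using integrable_gcut by simp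
    show "norm (gcut n w * (norm (qft I g w))\<^sup>2) \<le> gcut n w * (LINT t|lborel. norm (g t))\<^sup>2" for w
      using power_mono[OF qft_bd norm_ge_zero, of w 2] by (simp add: abs_mult gcut_bounds mult_left_mono)
  qed measurable
  have lim: "(\<lambda>n. LINT w|lborel. gcut n w * (norm (qft I g w))\<^sup>2) \<longlonglongrightarrow> L2sq g"
  proof -
    have eq: "smoothed_inner n g g = of_real (LINT w|lborel. gcut n w * (norm (qft I g w))\<^sup>2)" for n
    proof -
      have "smoothed_inner n g g = (LINT w|lborel. of_real (gcut n w * (norm (qft I g w))\<^sup>2))"
        using integral_gaussian_qft_mult[OF I g g, of n]
        by (simp add: qcnj_mult_self scaleR_conv_of_real)
      also have "\<dots> = of_real (LINT w|lborel. gcut n w * (norm (qft I g w))\<^sup>2)"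
        by (rule integral_bounded_linear[OF bounded_linear_of_real int])
      finally show ?thesis .
    qed
    have "(LINT t|lborel. qcnj (g t) * g t) = of_real (L2sq g)"
      unfolding qcnj_mult_self L2sq_def
      by (rule integral_bounded_linear[OF bounded_linear_of_real borel_L2_integrable[OF g(1)]])
    then have "(\<lambda>n. of_real (LINT w|lborel. gcut n w * (norm (qft I g w))\<^sup>2)) \<longlonglongrightarrow> (of_real (L2sq g) :: quat)"
      using smoothed_inner_tendsto[OF g g(1)] unfolding eq by simp
    then show ?thesis
      by (simp add: tendsto_of_real_iff)
  qed
  have mono: "AE w in lborel. mono (\<lambda>n. gcut n w * (norm (qft I g w))\<^sup>2)"
    by (intro AE_I2 monoI mult_right_mono gcut_mono) auto
  have pt: "AE w in lborel. (\<lambda>n. gcut n w * (norm (qft I g w))\<^sup>2) \<longlonglongrightarrow> (norm (qft I g w))\<^sup>2"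
  proof (rule AE_I2)
    fix w
    have "(\<lambda>n. gcut n w * (norm (qft I g w))\<^sup>2) \<longlonglongrightarrow> 1 * (norm (qft I g w))\<^sup>2"
      by (intro tendsto_mult gcut_tendsto tendsto_const)
    then show "(\<lambda>n. gcut n w * (norm (qft I g w))\<^sup>2) \<longlonglongrightarrow> (norm (qft I g w))\<^sup>2"
      by simp
  qed
  have meas: "(\<lambda>w. (norm (qft I g w))\<^sup>2) \<in> borel_measurable lborel"
    by measurable
  show "integrable lborel (\<lambda>w. (norm (qft I g w))\<^sup>2)"
    by (rule integrable_monotone_convergence[OF int mono pt lim meas])
  show "(LINT w|lborel. (norm (qft I g w))\<^sup>2) = L2sq g"
    by (rule integral_monotone_convergence[OF int mono pt lim meas])
qed

text \<open>The mixed product is not monotone in the cutoff, but half the sum of the two squared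
  norms, integrable by \<open>plancherel_norm\<close>, is a majorant. No polarisation over the
  quaternions is involved.\<close>

lemma plancherel:
  assumes I: "I \<in> \<bbbS>" and h: "borel_L2 h" "integrable lborel h" and g: "borel_L2 g" "integrable lborel g"
  shows "(LINT w|lborel. qcnj (qft I h w) * qft I g w) = (LINT t|lborel. qcnj (h t) * g t)"
proof (rule LIMSEQ_unique)
  note [measurable] = h(1)[THEN borel_L2_measurable] g(1)[THEN borel_L2_measurable]
  show "(\<lambda>n. smoothed_inner n h g) \<longlonglongrightarrow> (LINT t|lborel. qcnj (h t) * g t)"
    by (rule smoothed_inner_tendsto[OF h g(1)])
  show "(\<lambda>n. smoothed_inner n h g) \<longlonglongrightarrow> (LINT w|lborel. qcnj (qft I h w) * qft I g w)"
    unfolding integral_gaussian_qft_mult[OF I h g, symmetric]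
  proof (rule integral_dominated_convergence)
    show "integrable lborel (\<lambda>w. ((norm (qft I h w))\<^sup>2 + (norm (qft I g w))\<^sup>2) / 2)"
      using plancherel_norm(1)[OF I h] plancherel_norm(1)[OF I g] by simp
    have "(\<lambda>n. gcut n w *\<^sub>R (qcnj (qft I h w) * qft I g w))
        \<longlonglongrightarrow> 1 *\<^sub>R (qcnj (qft I h w) * qft I g w)" for w
      by (intro tendsto_scaleR gcut_tendsto tendsto_const)
    then show "AE w in lborel. (\<lambda>n. gcut n w *\<^sub>R (qcnj (qft I h w) * qft I g w))
        \<longlonglongrightarrow> qcnj (qft I h w) * qft I g w"
      by (intro AE_I2) (simp only: scaleR_one)
    show "AE w in lborel. norm (gcut n w *\<^sub>R (qcnj (qft I h w) * qft I g w))
        \<le> ((norm (qft I h w))\<^sup>2 + (norm (qft I g w))\<^sup>2) / 2" for n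
    proof (rule AE_I2)
      fix w
      have "gcut n w * (norm (qft I h w) * norm (qft I g w))
          \<le> 1 * (norm (qft I h w) * norm (qft I g w))"
        by (intro mult_right_mono gcut_bounds) auto
      also have "\<dots> \<le> ((norm (qft I h w))\<^sup>2 + (norm (qft I g w))\<^sup>2) / 2"
        using weighted_AM_GM[of 1 "norm (qft I h w)" "norm (qft I g w)"] by simp
      finally show "norm (gcut n w *\<^sub>R (qcnj (qft I h w) * qft I g w))
        \<le> ((norm (qft I h w))\<^sup>2 + (norm (qft I g w))\<^sup>2) / 2"
        by (simp add: norm_mult gcut_bounds)
    qed
  qed measurable
qed

subsection \<open>The Gabor transform and Moyal's identity\<close>

definition windowed :: "(real \<Rightarrow> quat) \<Rightarrow> real \<Rightarrow> real \<Rightarrow> quat" where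
  "windowed f x t = exp (- (pi * (t - x)\<^sup>2)) *\<^sub>R f t"

text \<open>The window is the Gaussian without its normalising factor; powers of 2 enter only in
  \<open>QSTFT_eq_gabor\<close>.\<close>

definition gabor :: "quat \<Rightarrow> (real \<Rightarrow> quat) \<Rightarrow> real \<Rightarrow> real \<Rightarrow> quat" where
  "gabor I f x w = qft I (windowed f x) w"

lemma windowed_measurable [measurable]:
  assumes [measurable]: "f \<in> borel_measurable borel"
  shows "windowed f x \<in> borel_measurable borel"
  unfolding windowed_def[abs_def] by measurable

lemma gabor_measurable:
  assumes [measurable]: "f \<in> borel_measurable borel"
  shows "(\<lambda>(x, w). gabor I f x w) \<in> borel_measurable (lborel \<Otimes>\<^sub>M lborel)"
  unfolding gabor_def qft_def windowed_def by measurable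

lemma gaussian_window:
  "integrable lborel (\<lambda>t. exp (- (pi * (t - x)\<^sup>2)))"
  "(LINT t|lborel. exp (- (pi * (t - x)\<^sup>2))) = 1"
  using has_bochner_integral_gaussian[of 1 x] by (simp_all add: has_bochner_integral_iff)

lemma gaussian_window_sq: "(exp (- (pi * (t - x)\<^sup>2)))\<^sup>2 = exp (- (pi * 2 * (t - x)\<^sup>2))"
  by (simp add: power2_eq_square flip: exp_add)

text \<open>The squared norm of the window, which is where the \<open>1 / sqrt 2\<close> of
  \<open>moyal\<close> comes from.\<close>

lemma gaussian_window_2:
  "integrable lborel (\<lambda>x. exp (- (pi * 2 * (t - x)\<^sup>2)))"
  "(LINT x|lborel. exp (- (pi * 2 * (t - x)\<^sup>2))) = 1 / sqrt 2"
  using has_bochner_integral_gaussian[of 2 t]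
  by (simp_all add: has_bochner_integral_iff power2_commute[of t])

lemma windowed_L2:
  assumes f: "borel_L2 f"
  shows "borel_L2 (windowed f x)"
proof -
  note [measurable] = f[THEN borel_L2_measurable]
  have "integrable lborel (\<lambda>t. (norm (windowed f x t))\<^sup>2)"
  proof (rule integrable_norm_le[OF borel_L2_integrable[OF f]])
    show "norm ((norm (windowed f x t))\<^sup>2) \<le> (norm (f t))\<^sup>2" for t
      by (simp add: windowed_def power_mult_distrib mult_left_le_one_le power_le_one)
  qed measurable
  then show ?thesis
    by (simp add: borel_L2_def)
qed

text \<open>A product of two square integrable functions, with the square of the window bounded by
  the window itself; the majorant has the explicit integral \<open>1 + L2sq f\<close>.\<close>

lemma norm_windowed_le: "norm (windowed f x t) \<le> exp (- (pi * (t - x)\<^sup>2)) + (norm (f t))\<^sup>2"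
proof -
  define w where "w = exp (- (pi * (t - x)\<^sup>2))"
  have w: "0 \<le> w" "w \<le> 1" by (simp_all add: w_def)
  have "w * norm (f t) \<le> (w\<^sup>2 + (norm (f t))\<^sup>2) / 2"
    using weighted_AM_GM[of 1 w "norm (f t)"] by simp
  moreover have "w\<^sup>2 \<le> w"
    using w by (simp add: power2_eq_square mult_left_le)
  moreover have "0 \<le> (norm (f t))\<^sup>2" by simp
  ultimately have "w * norm (f t) \<le> w + (norm (f t))\<^sup>2"
    using w by argo
  then show "norm (windowed f x t) \<le> exp (- (pi * (t - x)\<^sup>2)) + (norm (f t))\<^sup>2"
    by (simp add: windowed_def w_def)
qed

lemma integrable_norm_windowed_bound:
  "borel_L2 f \<Longrightarrow> integrable lborel (\<lambda>t. exp (- (pi * (t - x)\<^sup>2)) + (norm (f t))\<^sup>2)"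
  by (intro Bochner_Integration.integrable_add gaussian_window borel_L2_integrable)

lemma windowed_integrable:
  assumes f: "borel_L2 f"
  shows "integrable lborel (windowed f x)"
  using borel_L2_measurable[OF f]
  by (intro integrable_norm_le[OF integrable_norm_windowed_bound[OF f, of x]] norm_windowed_le) simp

text \<open>A bound uniform in phase space makes the inversion integrand absolutely integrable over
  bounded sets.\<close>

lemma gabor_bounded:
  assumes I: "I \<in> \<bbbS>" and f: "borel_L2 f"
  shows "norm (gabor I f x w) \<le> 1 + L2sq f"
proof -
  note [measurable] = f[THEN borel_L2_measurable]
  have "norm (gabor I f x w) \<le> (LINT t|lborel. norm (slice I (cis (- (2 * pi * w * t))) * windowed f x t))"
    unfolding gabor_def qft_def by (rule integral_norm_bound)
  also have "\<dots> = (LINT t|lborel. norm (windowed f x t))"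
    by (simp add: norm_mult norm_slice[OF I])
  also have "\<dots> \<le> (LINT t|lborel. exp (- (pi * (t - x)\<^sup>2)) + (norm (f t))\<^sup>2)"
  proof (rule integral_mono)
    show "integrable lborel (\<lambda>t. norm (windowed f x t))"
      by (intro integrable_norm windowed_integrable f)
  qed (simp_all only: integrable_norm_windowed_bound f norm_windowed_le)
  also have "\<dots> = 1 + L2sq f"
    using gaussian_window[of x] borel_L2_integrable[OF f] by (simp add: L2sq_def)
  finally show ?thesis .
qed

text \<open>Fubini with the \<open>x\<close>-integral inside, which does not depend on
  \<open>t\<close>. The target space is kept general to cover both the squared norm of
  \<open>f\<close> and the product \<open>qcnj (h t) * f t\<close>.\<close>

lemma window_product_integral:
  fixes u :: "real \<Rightarrow> 'a::{banach, second_countable_topology}"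
  assumes u: "integrable lborel u"
  shows "integrable lborel (\<lambda>x. LINT t|lborel. exp (- (pi * 2 * (t - x)\<^sup>2)) *\<^sub>R u t)"
    and "(LINT x|lborel. LINT t|lborel. exp (- (pi * 2 * (t - x)\<^sup>2)) *\<^sub>R u t)
      = (1 / sqrt 2) *\<^sub>R integral\<^sup>L lborel u"
proof -
  have [measurable]: "u \<in> borel_measurable borel"
    using borel_measurable_integrable[OF u] by simp
  have *: "integrable (lborel \<Otimes>\<^sub>M lborel) (\<lambda>(t, x). exp (- (pi * 2 * (t - x)\<^sup>2)) *\<^sub>R u t)"
  proof (rule lborel_pair.Fubini_integrable)
    have "(\<lambda>t. LINT x|lborel. norm (case (t, x) of (t, x) \<Rightarrow> exp (- (pi * 2 * (t - x)\<^sup>2)) *\<^sub>R u t))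
        = (\<lambda>t. 1 / sqrt 2 * norm (u t))"
      using gaussian_window_2 by simp
    then show "integrable lborel
        (\<lambda>t. LINT x|lborel. norm (case (t, x) of (t, x) \<Rightarrow> exp (- (pi * 2 * (t - x)\<^sup>2)) *\<^sub>R u t))"
      using u by simp
    show "AE t in lborel. integrable lborel
        (\<lambda>x. case (t, x) of (t, x) \<Rightarrow> exp (- (pi * 2 * (t - x)\<^sup>2)) *\<^sub>R u t)"
      using gaussian_window_2(1) by (intro AE_I2) (simp add: integrable_scaleR_left)
  qed measurable
  show "integrable lborel (\<lambda>x. LINT t|lborel. exp (- (pi * 2 * (t - x)\<^sup>2)) *\<^sub>R u t)"
    by (rule lborel_pair.integrable_snd[OF *])
  have "(LINT x|lborel. LINT t|lborel. exp (- (pi * 2 * (t - x)\<^sup>2)) *\<^sub>R u t)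
     = (LINT t|lborel. LINT x|lborel. exp (- (pi * 2 * (t - x)\<^sup>2)) *\<^sub>R u t)"
    by (rule lborel_pair.Fubini_integral[OF *])
  also have "\<dots> = (LINT t|lborel. (1 / sqrt 2) *\<^sub>R u t)"
  proof -
    have "(LINT x|lborel. exp (- (pi * 2 * (t - x)\<^sup>2)) *\<^sub>R u t) = (1 / sqrt 2) *\<^sub>R u t" for t
      using gaussian_window_2[of t] by (simp only: integral_scaleR_left)
    then show ?thesis by simp
  qed
  finally show "(LINT x|lborel. LINT t|lborel. exp (- (pi * 2 * (t - x)\<^sup>2)) *\<^sub>R u t)
      = (1 / sqrt 2) *\<^sub>R integral\<^sup>L lborel u"
    by simp
qed

lemma gabor_norm:
  assumes I: "I \<in> \<bbbS>" and f: "borel_L2 f"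
  shows "integrable (lborel \<Otimes>\<^sub>M lborel) (\<lambda>(x, w). (norm (gabor I f x w))\<^sup>2)"
    and "integral\<^sup>L (lborel \<Otimes>\<^sub>M lborel) (\<lambda>(x, w). (norm (gabor I f x w))\<^sup>2) = L2sq f / sqrt 2"
proof -
  note [measurable] = f[THEN borel_L2_measurable] gabor_measurable
  have inner: "(LINT w|lborel. (norm (gabor I f x w))\<^sup>2)
      = (LINT t|lborel. exp (- (pi * 2 * (t - x)\<^sup>2)) *\<^sub>R (norm (f t))\<^sup>2)" for x
    using plancherel_norm(2)[OF I windowed_L2[OF f] windowed_integrable[OF f], of x]
    by (simp add: gabor_def L2sq_def windowed_def power_mult_distrib gaussian_window_sq)
  have "(\<lambda>(x, w). (norm (gabor I f x w))\<^sup>2) = (\<lambda>p. (norm (case p of (x, w) \<Rightarrow> gabor I f x w))\<^sup>2)"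
    by auto
  then have [measurable]: "(\<lambda>(x, w). (norm (gabor I f x w))\<^sup>2) \<in> borel_measurable (lborel \<Otimes>\<^sub>M lborel)"
    using gabor_measurable[of f I] by simp
  show *: "integrable (lborel \<Otimes>\<^sub>M lborel) (\<lambda>(x, w). (norm (gabor I f x w))\<^sup>2)"
  proof (rule lborel_pair.Fubini_integrable)
    show "integrable lborel (\<lambda>x. LINT w|lborel. norm (case (x, w) of (x, w) \<Rightarrow> (norm (gabor I f x w))\<^sup>2))"
      using window_product_integral(1)[OF borel_L2_integrable[OF f]] by (simp add: inner)
    show "AE x in lborel. integrable lborel (\<lambda>w. case (x, w) of (x, w) \<Rightarrow> (norm (gabor I f x w))\<^sup>2)"
      using plancherel_norm(1)[OF I windowed_L2[OF f] windowed_integrable[OF f]] by (simp add: gabor_def)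
  qed measurable
  show "integral\<^sup>L (lborel \<Otimes>\<^sub>M lborel) (\<lambda>(x, w). (norm (gabor I f x w))\<^sup>2) = L2sq f / sqrt 2"
    using lborel_pair.integral_fst[OF *] window_product_integral(2)[OF borel_L2_integrable[OF f]]
    by (simp add: inner L2sq_def)
qed

lemma moyal:
  assumes I: "I \<in> \<bbbS>" and h: "borel_L2 h" and f: "borel_L2 f"
  shows "integrable (lborel \<Otimes>\<^sub>M lborel) (\<lambda>(x, w). qcnj (gabor I h x w) * gabor I f x w)"
    and "integral\<^sup>L (lborel \<Otimes>\<^sub>M lborel) (\<lambda>(x, w). qcnj (gabor I h x w) * gabor I f x w)
      = (1 / sqrt 2) *\<^sub>R (LINT t|lborel. qcnj (h t) * f t)"
proof -
  have [measurable]: "(\<lambda>(x, w). gabor I h x w) \<in> borel_measurable (lborel \<Otimes>\<^sub>M lborel)"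
    "(\<lambda>(x, w). gabor I f x w) \<in> borel_measurable (lborel \<Otimes>\<^sub>M lborel)"
    by (simp_all only: gabor_measurable f[THEN borel_L2_measurable] h[THEN borel_L2_measurable])
  have eq: "(\<lambda>(x, w). qcnj (gabor I h x w) * gabor I f x w)
      = (\<lambda>p. qcnj ((\<lambda>(x, w). gabor I h x w) p) * (\<lambda>(x, w). gabor I f x w) p)"
    by auto
  show *: "integrable (lborel \<Otimes>\<^sub>M lborel) (\<lambda>(x, w). qcnj (gabor I h x w) * gabor I f x w)"
  proof (rule integrable_norm_le)
    show "integrable (lborel \<Otimes>\<^sub>M lborel) (\<lambda>p. ((\<lambda>(x, w). (norm (gabor I h x w))\<^sup>2) p
        + (\<lambda>(x, w). (norm (gabor I f x w))\<^sup>2) p) / 2)"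
      by (intro integrable_divide_zero impI Bochner_Integration.integrable_add gabor_norm I h f)
    show "(\<lambda>(x, w). qcnj (gabor I h x w) * gabor I f x w) \<in> borel_measurable (lborel \<Otimes>\<^sub>M lborel)"
      unfolding eq by measurable
    show "norm ((\<lambda>(x, w). qcnj (gabor I h x w) * gabor I f x w) p) \<le> ((\<lambda>(x, w). (norm (gabor I h x w))\<^sup>2) p
        + (\<lambda>(x, w). (norm (gabor I f x w))\<^sup>2) p) / 2" for p
      using weighted_AM_GM[of 1 "norm (gabor I h (fst p) (snd p))" "norm (gabor I f (fst p) (snd p))"]
      by (simp add: norm_mult case_prod_unfold)
  qed
  have inner: "(LINT w|lborel. qcnj (gabor I h x w) * gabor I f x w)
      = (LINT t|lborel. exp (- (pi * 2 * (t - x)\<^sup>2)) *\<^sub>R (qcnj (h t) * f t))" for x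
  proof -
    have "qcnj (windowed h x t) * windowed f x t = exp (- (pi * 2 * (t - x)\<^sup>2)) *\<^sub>R (qcnj (h t) * f t)" for t
      by (simp add: windowed_def qcnj_scaleR flip: gaussian_window_sq power2_eq_square)
    then show ?thesis
      using plancherel[OF I windowed_L2[OF h] windowed_integrable[OF h] windowed_L2[OF f] windowed_integrable[OF f], of x x]
      by (simp only: gabor_def)
  qed
  show "integral\<^sup>L (lborel \<Otimes>\<^sub>M lborel) (\<lambda>(x, w). qcnj (gabor I h x w) * gabor I f x w)
      = (1 / sqrt 2) *\<^sub>R (LINT t|lborel. qcnj (h t) * f t)"
    using lborel_pair.integral_fst[OF *] window_product_integral(2)[OF integrable_L2_mult(1)[OF h f]]
    by (simp add: inner)
qed

subsection \<open>The short-time Fourier transform as a Gabor transform\<close>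

text \<open>The point \<open>z\<close> is the conjugate of x + i w divided by sqrt 2. Completing the
  square leaves the window exponent, the Fourier phase, and two terms free of \<open>t\<close>; the
  outer factors of \<open>QSTFT\<close> cancel exactly these two.\<close>

lemma segal_bargmann_exponent:
  fixes x w t :: real
  defines "z \<equiv> (complex_of_real x - \<i> * complex_of_real w) /\<^sub>R sqrt 2"
  shows "- pi *\<^sub>R (z\<^sup>2 + complex_of_real (t\<^sup>2)) + (2 * pi * sqrt 2 * t) *\<^sub>R z
    = complex_of_real (pi * (x\<^sup>2 + w\<^sup>2) / 2 - pi * (t - x)\<^sup>2) + \<i> * complex_of_real (pi * x * w - 2 * pi * w * t)"
proof -
  have z2: "z\<^sup>2 = (complex_of_real x - \<i> * complex_of_real w)\<^sup>2 /\<^sub>R 2"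
    by (simp add: z_def scaleR_power power_inverse)
  have z1: "(2 * pi * sqrt 2 * t) *\<^sub>R z = (2 * pi * t) *\<^sub>R (complex_of_real x - \<i> * complex_of_real w)"
    by (simp add: z_def)
  then show ?thesis
    unfolding z2 z1 by (simp add: complex_eq_iff power2_eq_square algebra_simps)
qed

lemma segal_bargmann_kernel_slice:
  assumes I: "I \<in> \<bbbS>"
  shows "exp (- pi *\<^sub>R ((slice I z)\<^sup>2 + of_real (t\<^sup>2)) + (2 * pi * sqrt 2 * t) *\<^sub>R slice I z)
    = slice I (exp (- pi *\<^sub>R (z\<^sup>2 + complex_of_real (t\<^sup>2)) + (2 * pi * sqrt 2 * t) *\<^sub>R z))"
  by (simp only: slice_exp[OF I] slice_add slice_scaleR slice_power[OF I] slice_of_real slice_minus)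

lemma qcnj_slice_point:
  assumes I: "I \<in> \<bbbS>"
  shows "qcnj (of_real x + I * of_real w) /\<^sub>R sqrt 2
    = slice I ((complex_of_real x - \<i> * complex_of_real w) /\<^sub>R sqrt 2)"
proof -
  have "of_real x + I * of_real w = slice I (of_real x + \<i> * of_real w)"
    by (simp add: slice_add slice_mult[OF I])
  then show ?thesis
    by (simp add: qcnj_slice[OF I] flip: slice_scaleR)
qed

text \<open>The part of the kernel that is free of \<open>t\<close> is the real factor
  \<open>r\<close> times the phase \<open>e\<close>. Both can be pulled out to the left, where
  \<open>e\<close> cancels against the phase in \<open>QSTFT\<close> and \<open>r\<close> against
  its Gaussian factor.\<close>

lemma QSTFT_eq_gabor:
  assumes I: "I \<in> \<bbbS>" and f: "borel_L2 f"
  shows "QSTFT I f x w = 2 powr (3/4) *\<^sub>R gabor I f x w"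
proof -
  note [measurable] = f[THEN borel_L2_measurable]
  define q where "q = of_real x + I * of_real w"
  have q: "q = slice I (of_real x + \<i> * of_real w)"
    by (simp add: q_def slice_add slice_mult[OF I])
  have nq: "(norm q)\<^sup>2 = x\<^sup>2 + w\<^sup>2"
    by (simp add: q norm_slice[OF I] cmod_def)
  define r where "r = exp (pi * (x\<^sup>2 + w\<^sup>2) / 2)"
  define z where "z = (complex_of_real x - \<i> * complex_of_real w) /\<^sub>R sqrt 2"
  have z: "qcnj q /\<^sub>R sqrt 2 = slice I z"
    unfolding q_def z_def by (rule qcnj_slice_point[OF I])
  define e where "e = slice I (cis (pi * x * w))"
  have e: "slice I (cis (- (pi * x * w))) * e = 1"
    by (simp add: e_def cis_mult flip: slice_mult[OF I])
  have *: "exp (- pi *\<^sub>R ((slice I z)\<^sup>2 + of_real (t\<^sup>2)) + (2 * pi * sqrt 2 * t) *\<^sub>R slice I z)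
      = (r * exp (- (pi * (t - x)\<^sup>2))) *\<^sub>R (e * slice I (cis (- (2 * pi * w * t))))" for t
  proof -
    have "exp (- pi *\<^sub>R ((slice I z)\<^sup>2 + of_real (t\<^sup>2)) + (2 * pi * sqrt 2 * t) *\<^sub>R slice I z)
        = slice I (exp (complex_of_real (pi * (x\<^sup>2 + w\<^sup>2) / 2 - pi * (t - x)\<^sup>2)
            + \<i> * complex_of_real (pi * x * w - 2 * pi * w * t)))"
      by (simp only: segal_bargmann_kernel_slice[OF I] z_def segal_bargmann_exponent)
    also have "exp (complex_of_real (pi * (x\<^sup>2 + w\<^sup>2) / 2 - pi * (t - x)\<^sup>2)
            + \<i> * complex_of_real (pi * x * w - 2 * pi * w * t))
        = (r * exp (- (pi * (t - x)\<^sup>2))) *\<^sub>R (cis (pi * x * w) * cis (- (2 * pi * w * t)))"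
    proof -
      have "exp (complex_of_real a + \<i> * complex_of_real b) = exp a *\<^sub>R cis b" for a b
        by (simp only: exp_add exp_of_real cis_conv_exp scaleR_conv_of_real)
      moreover have "exp (pi * (x\<^sup>2 + w\<^sup>2) / 2 - pi * (t - x)\<^sup>2) = r * exp (- (pi * (t - x)\<^sup>2))"
        by (simp add: r_def flip: exp_add)
      ultimately show ?thesis
        by (simp only: cis_mult diff_conv_add_uminus)
    qed
    finally show ?thesis
      by (simp only: slice_scaleR slice_mult[OF I] e_def)
  qed
  have int: "integrable lborel (\<lambda>t. slice I (cis (- (2 * pi * w * t))) * windowed f x t)"
    using integrable_qft(1)[OF I windowed_integrable[OF f], of "- (2 * pi * w)" x] by simp
  have "segal_bargmann f (slice I z)
      = (LINT t|lebesgue. ((2 powr (3/4) * r) *\<^sub>R e) * (slice I (cis (- (2 * pi * w * t))) * windowed f x t))"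
    unfolding segal_bargmann_def *
    by (intro Bochner_Integration.integral_cong) (simp_all add: windowed_def mult.assoc)
  also have "\<dots> = (LINT t|lborel. ((2 powr (3/4) * r) *\<^sub>R e) * (slice I (cis (- (2 * pi * w * t))) * windowed f x t))"
    by (rule integral_completion) measurable
  also have "\<dots> = ((2 powr (3/4) * r) *\<^sub>R e) * gabor I f x w"
    unfolding gabor_def qft_def by (rule Bochner_Integration.integral_mult_right) (rule int)
  finally have B: "segal_bargmann f (slice I z) = ((2 powr (3/4) * r) *\<^sub>R e) * gabor I f x w" .
  have E: "exp (- (I * of_real (pi * x * w))) = slice I (cis (- (pi * x * w)))"
  proof -
    have "- (I * of_real (pi * x * w)) = slice I (\<i> * complex_of_real (- (pi * x * w)))"
      by (simp only: slice_mult[OF I] slice_i slice_of_real) simp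
    then show ?thesis
      by (simp only: cis_conv_exp slice_exp[OF I])
  qed
  have "QSTFT I f x w = slice I (cis (- (pi * x * w))) * (((2 powr (3/4) * r) *\<^sub>R e) * gabor I f x w)
      * of_real (exp (- (pi * (x\<^sup>2 + w\<^sup>2) / 2)))"
    unfolding QSTFT_def Let_def q_def[symmetric] z B E nq ..
  also have "\<dots> = (2 powr (3/4) * (r * exp (- (pi * (x\<^sup>2 + w\<^sup>2) / 2))))
      *\<^sub>R (slice I (cis (- (pi * x * w))) * e * gabor I f x w)"
    by (simp add: quat_mult_of_real mult.assoc mult_ac)
  also have "r * exp (- (pi * (x\<^sup>2 + w\<^sup>2) / 2)) = 1"
    by (simp add: r_def flip: exp_add)
  finally show ?thesis
    by (simp add: e)
qed

lemma inversion_integrand_eq: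
  assumes I: "I \<in> \<bbbS>" and f: "borel_L2 f"
  shows "inversion_integrand I f y (x, w)
    = (2 powr (3/4) * exp (- (pi * (y - x)\<^sup>2))) *\<^sub>R (slice I (cis (2 * pi * w * y)) * gabor I f x w)"
proof -
  have "I * of_real (2 * pi * w * y) = slice I (\<i> * complex_of_real (2 * pi * w * y))"
    by (simp only: slice_mult[OF I] slice_i slice_of_real)
  then have "exp (I * of_real (2 * pi * w * y)) = slice I (cis (2 * pi * w * y))"
    by (simp only: cis_conv_exp slice_exp[OF I])
  then show ?thesis
    by (simp add: inversion_integrand_def QSTFT_eq_gabor[OF I f] quat_mult_of_real mult_ac)
qed

lemma inversion_integrand_measurable2:
  assumes I: "I \<in> \<bbbS>" and f: "borel_L2 f"
  shows "(\<lambda>(y, p). inversion_integrand I f y p) \<in> borel_measurable (lborel \<Otimes>\<^sub>M lborel)"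
proof -
  note [measurable] = f[THEN borel_L2_measurable]
  have "(\<lambda>p. gabor I f (fst p) (snd p)) \<in> borel_measurable (lborel \<Otimes>\<^sub>M lborel)"
    using gabor_measurable[of f I] by (simp add: case_prod_unfold)
  then have [measurable]: "(\<lambda>p. gabor I f (fst p) (snd p)) \<in> borel_measurable (borel \<Otimes>\<^sub>M borel)"
    by (simp cong: measurable_cong_sets)
  have "(\<lambda>(y, p). inversion_integrand I f y p) = (\<lambda>(y, p). (2 powr (3/4) * exp (- (pi * (y - fst p)\<^sup>2)))
      *\<^sub>R (slice I (cis (2 * pi * snd p * y)) * gabor I f (fst p) (snd p)))"
    using inversion_integrand_eq[OF I f] by (auto simp: fun_eq_iff)
  also have "\<dots> \<in> borel_measurable (lborel \<Otimes>\<^sub>M lborel)"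
    unfolding lborel_prod[symmetric] by measurable
  finally show ?thesis .
qed

lemma inversion_integrand_measurable:
  assumes I: "I \<in> \<bbbS>" and f: "borel_L2 f"
  shows "inversion_integrand I f y \<in> borel_measurable borel"
  using measurable_compose[OF measurable_Pair1' inversion_integrand_measurable2[OF I f], of y]
  by simp

lemma norm_inversion_integrand_le:
  assumes I: "I \<in> \<bbbS>" and f: "borel_L2 f"
  shows "norm (inversion_integrand I f y (x, w)) \<le> 2 powr (3/4) * (1 + L2sq f) * exp (- (pi * (y - x)\<^sup>2))"
  using gabor_bounded[OF I f, of x w]
  by (simp add: inversion_integrand_eq[OF I f] norm_mult norm_slice[OF I] mult_left_mono mult_ac)

text \<open>The window and modulation that synthesise at \<open>y\<close> are the conjugate of the
  analysing kernel, so pairing with \<open>h\<close> reproduces the transform of \<open>h\<close>;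
  the value \<open>gabor I f x w\<close> does not depend on \<open>y\<close> and leaves the integral
  on the right.\<close>

lemma inversion_integrand_inner:
  assumes I: "I \<in> \<bbbS>" and f: "borel_L2 f" and h: "borel_L2 h"
  shows "(LINT y|lborel. qcnj (h y) * inversion_integrand I f y (x, w))
    = 2 powr (3/4) *\<^sub>R (qcnj (gabor I h x w) * gabor I f x w)"
proof -
  have int: "integrable lborel (\<lambda>y. qcnj (windowed h x y) * slice I (cis (2 * pi * w * y)))"
    by (rule integrable_qft(2)[OF I integrable_bounded_linear[OF bounded_linear_qcnj windowed_integrable[OF h]]])
  have "qcnj (h y) * inversion_integrand I f y (x, w)
      = 2 powr (3/4) *\<^sub>R ((qcnj (windowed h x y) * slice I (cis (2 * pi * w * y))) * gabor I f x w)" for y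
    by (simp add: inversion_integrand_eq[OF I f] windowed_def qcnj_scaleR mult.assoc)
  then show ?thesis
    using int by (simp add: gabor_def[of I h] qcnj_qft[OF I windowed_integrable[OF h]])
qed

text \<open>Prefactor of the inversion formula times the factor from \<open>QSTFT_eq_gabor\<close>:
  exactly what cancels the \<open>1 / sqrt 2\<close> in \<open>moyal\<close>.\<close>

lemma two_powr_consts:
  "2 powr (- 1/4) * 2 powr (3/4) = sqrt (2 :: real)"
  by (simp add: powr_half_sqrt flip: powr_add)

lemma weak_inversion:
  assumes I: "I \<in> \<bbbS>" and f: "borel_L2 f" and h: "borel_L2 h"
  shows "integrable lborel (\<lambda>p. LINT y|lborel. qcnj (h y) * inversion_integrand I f y p)"
    and "(LINT y|lborel. qcnj (h y) * f y) = (2 powr (- 1/4)) *\<^sub>R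
      (LINT p|lborel. LINT y|lborel. qcnj (h y) * inversion_integrand I f y p)"
proof -
  have eq: "(\<lambda>p. LINT y|lborel. qcnj (h y) * inversion_integrand I f y p)
     = (\<lambda>p. 2 powr (3/4) *\<^sub>R (case p of (x, w) \<Rightarrow> qcnj (gabor I h x w) * gabor I f x w))"
    by (auto simp: inversion_integrand_inner[OF I f h] fun_eq_iff)
  show "integrable lborel (\<lambda>p. LINT y|lborel. qcnj (h y) * inversion_integrand I f y p)"
    unfolding eq using moyal(1)[OF I h f] by (simp add: lborel_prod)
  show "(LINT y|lborel. qcnj (h y) * f y) = (2 powr (- 1/4)) *\<^sub>R
      (LINT p|lborel. LINT y|lborel. qcnj (h y) * inversion_integrand I f y p)"
    unfolding eq using moyal(2)[OF I h f] two_powr_consts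
    by (simp add: lborel_prod mult.assoc[symmetric])
qed

subsection \<open>Norm convergence of the truncated inversion integrals\<close>

definition trunc_inv :: "quat \<Rightarrow> (real \<Rightarrow> quat) \<Rightarrow> (real \<times> real) set \<Rightarrow> real \<Rightarrow> quat" where
  "trunc_inv I f K y = (2 powr (- 1/4)) *\<^sub>R (LINT p|lborel. indicator K p *\<^sub>R inversion_integrand I f y p)"

lemma inversion_over_eq:
  assumes I: "I \<in> \<bbbS>" and f: "borel_L2 f" and K: "K \<in> sets borel"
  shows "inversion_over I f K y = trunc_inv I f K y"
proof -
  note [measurable] = inversion_integrand_measurable[OF I f] K
  show ?thesis
    unfolding inversion_over_def trunc_inv_def set_lebesgue_integral_def
    by (subst integral_completion) (auto, measurable)
qed

text \<open>On a bounded set the window centres stay bounded, so all translated Gaussians lie below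
  a multiple of one fixed Gaussian in \<open>y\<close> of half the rate. This separates
  \<open>y\<close> from \<open>p\<close> for Fubini.\<close>

lemma truncated_integrand_bound:
  assumes I: "I \<in> \<bbbS>" and f: "borel_L2 f" and K: "bounded K"
  obtains C where "C \<ge> 0"
    "\<And>y p. norm (indicator K p *\<^sub>R inversion_integrand I f y p) \<le> C * indicator K p * exp (- (pi * y\<^sup>2 / 2))"
proof -
  obtain R where R: "\<And>p. p \<in> K \<Longrightarrow> norm p \<le> R"
    using K by (auto simp: bounded_iff)
  define C where "C = 2 powr (3/4) * (1 + L2sq f) * exp (pi * R\<^sup>2)"
  have "norm (indicator K p *\<^sub>R inversion_integrand I f y p) \<le> C * indicator K p * exp (- (pi * y\<^sup>2 / 2))" for y p
  proof (cases "p \<in> K")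
    case True
    obtain x w where p: "p = (x, w)" by (cases p)
    have "\<bar>x\<bar> \<le> R"
      using R[OF True] norm_fst_le[of x w] by (simp add: p)
    then have "x\<^sup>2 \<le> R\<^sup>2"
      by (metis abs_ge_zero power2_abs power_mono)
    \<comment> \<open>This square encodes the inequality (y - x)^2 >= y^2 / 2 - x^2, the source of
      the halved rate.\<close>
    moreover have "0 \<le> (y - 2 * x)\<^sup>2"
      by simp
    moreover have "(y - 2 * x)\<^sup>2 = 2 * (y - x)\<^sup>2 + 2 * x\<^sup>2 - y\<^sup>2"
      by (simp add: power2_eq_square algebra_simps)
    ultimately have "y\<^sup>2 / 2 - R\<^sup>2 \<le> (y - x)\<^sup>2"
      by argo
    then have "pi * (y\<^sup>2 / 2 - R\<^sup>2) \<le> pi * (y - x)\<^sup>2"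
      by (intro mult_left_mono) auto
    then have "exp (- (pi * (y - x)\<^sup>2)) \<le> exp (pi * R\<^sup>2) * exp (- (pi * y\<^sup>2 / 2))"
      by (simp add: algebra_simps flip: exp_add)
    then have "2 powr (3/4) * (1 + L2sq f) * exp (- (pi * (y - x)\<^sup>2))
        \<le> 2 powr (3/4) * (1 + L2sq f) * (exp (pi * R\<^sup>2) * exp (- (pi * y\<^sup>2 / 2)))"
      using L2sq_nonneg[of f] by (intro mult_left_mono) auto
    from order_trans[OF norm_inversion_integrand_le[OF I f, of y x w] this] show ?thesis
      using True by (simp add: p C_def mult.assoc)
  qed simp
  moreover have "C \<ge> 0"
    using L2sq_nonneg[of f] by (simp add: C_def)
  ultimately show ?thesis
    using that by blast
qed

lemma integrable_indicator_bounded: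
  assumes "bounded K" "K \<in> sets borel"
  shows "integrable lborel (indicator K :: real \<times> real \<Rightarrow> real)"
  using assms emeasure_bounded_finite[of K] by (simp add: integrable_indicator_iff)

lemma integrable_truncated:
  assumes I: "I \<in> \<bbbS>" and f: "borel_L2 f" and K: "bounded K" "K \<in> sets borel"
  shows "integrable lborel (\<lambda>p. indicator K p *\<^sub>R inversion_integrand I f y p)"
proof -
  note [measurable] = inversion_integrand_measurable[OF I f] K(2)
  obtain C where C: "C \<ge> 0"
    "\<And>y p. norm (indicator K p *\<^sub>R inversion_integrand I f y p) \<le> C * indicator K p * exp (- (pi * y\<^sup>2 / 2))"
    using truncated_integrand_bound[OF I f K(1)] by blast
  show ?thesis
  proof (rule integrable_norm_le)
    show "integrable lborel (\<lambda>p. C * indicator K p * exp (- (pi * y\<^sup>2 / 2)))"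
      by (intro integrable_mult_left integrable_mult_right integrable_indicator_bounded K)
  qed (measurable, rule C(2))
qed

lemma gaussian_halfwidth:
  "integrable lborel (\<lambda>y. exp (- (pi * y\<^sup>2 / 2)))" "integrable lborel (\<lambda>y. (exp (- (pi * y\<^sup>2 / 2)))\<^sup>2)"
proof -
  show "integrable lborel (\<lambda>y. exp (- (pi * y\<^sup>2 / 2)))"
    using has_bochner_integral_gaussian[of "1/2" 0] by (simp add: has_bochner_integral_iff)
  have "(exp (- (pi * y\<^sup>2 / 2)))\<^sup>2 = exp (- (pi * (y - 0)\<^sup>2))" for y
    by (simp add: power2_eq_square[of "exp _"] flip: exp_add)
  then show "integrable lborel (\<lambda>y. (exp (- (pi * y\<^sup>2 / 2)))\<^sup>2)"
    using gaussian_window(1)[of 0] by simp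
qed

lemma borel_L2_trunc_inv:
  assumes I: "I \<in> \<bbbS>" and f: "borel_L2 f" and K: "bounded K" "K \<in> sets borel"
  shows "borel_L2 (trunc_inv I f K)"
proof -
  note [measurable] = inversion_integrand_measurable2[OF I f] K(2)
  have m: "trunc_inv I f K \<in> borel_measurable borel"
  proof -
    have "(\<lambda>(y, p). indicator K p *\<^sub>R inversion_integrand I f y p)
        = (\<lambda>z. indicator K (snd z) *\<^sub>R (case z of (y, p) \<Rightarrow> inversion_integrand I f y p))"
      by auto
    also have "\<dots> \<in> borel_measurable (borel \<Otimes>\<^sub>M lborel)"
      by measurable
    finally show ?thesis
      unfolding trunc_inv_def[abs_def] by measurable
  qed
  obtain C where C: "C \<ge> 0"
    "\<And>y p. norm (indicator K p *\<^sub>R inversion_integrand I f y p) \<le> C * indicator K p * exp (- (pi * y\<^sup>2 / 2))"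
    using truncated_integrand_bound[OF I f K(1)] by blast
  define D where "D = 2 powr (- 1/4) * (C * (LINT p|lborel. indicator K p))"
  have bd: "norm (trunc_inv I f K y) \<le> D * exp (- (pi * y\<^sup>2 / 2))" for y
  proof -
    have "norm (LINT p|lborel. indicator K p *\<^sub>R inversion_integrand I f y p)
        \<le> (LINT p|lborel. norm (indicator K p *\<^sub>R inversion_integrand I f y p))"
      by (rule integral_norm_bound)
    also have "\<dots> \<le> (LINT p|lborel. C * indicator K p * exp (- (pi * y\<^sup>2 / 2)))"
      by (intro integral_mono integrable_norm integrable_truncated I f K C(2)
            integrable_mult_left integrable_mult_right integrable_indicator_bounded)
    also have "\<dots> = C * (LINT p|lborel. indicator K p) * exp (- (pi * y\<^sup>2 / 2))"
      by (simp only: integral_mult_left_zero integral_mult_right_zero)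
    finally show ?thesis
      by (simp only: trunc_inv_def norm_scaleR D_def mult.assoc) (intro mult_mono, simp_all)
  qed
  have "integrable lborel (\<lambda>y. (norm (trunc_inv I f K y))\<^sup>2)"
  proof (rule integrable_norm_le)
    show "integrable lborel (\<lambda>y. D\<^sup>2 * (exp (- (pi * y\<^sup>2 / 2)))\<^sup>2)"
      by (intro integrable_mult_right gaussian_halfwidth)
    show "norm ((norm (trunc_inv I f K y))\<^sup>2) \<le> D\<^sup>2 * (exp (- (pi * y\<^sup>2 / 2)))\<^sup>2" for y
      using power_mono[OF bd norm_ge_zero, of y 2] by (simp only: power_mult_distrib) simp
  qed (use m in measurable)
  with m show ?thesis
    by (simp add: borel_L2_def)
qed

text \<open>Fubini, justified by the separated majorant: \<open>h\<close> pairs integrably with the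
  fixed Gaussian, and \<open>indicator K\<close> is integrable in \<open>p\<close>.\<close>

lemma trunc_inv_inner:
  assumes I: "I \<in> \<bbbS>" and f: "borel_L2 f" and h: "borel_L2 h" and K: "bounded K" "K \<in> sets borel"
  shows "(LINT y|lborel. qcnj (h y) * trunc_inv I f K y)
    = (2 powr (- 1/4)) *\<^sub>R
      (LINT p|lborel. indicator K p *\<^sub>R (LINT y|lborel. qcnj (h y) * inversion_integrand I f y p))"
proof -
  note [measurable] = inversion_integrand_measurable2[OF I f] K(2) h[THEN borel_L2_measurable]
  obtain C where C: "C \<ge> 0"
    "\<And>y p. norm (indicator K p *\<^sub>R inversion_integrand I f y p) \<le> C * indicator K p * exp (- (pi * y\<^sup>2 / 2))"
    using truncated_integrand_bound[OF I f K(1)] by blast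
  let ?\<Psi> = "\<lambda>(y, p). indicator K p *\<^sub>R (qcnj (h y) * inversion_integrand I f y p)"
  have hg: "integrable lborel (\<lambda>y. norm (h y) * exp (- (pi * y\<^sup>2 / 2)))"
  proof (rule integrable_norm_le)
    show "integrable lborel (\<lambda>y. ((norm (h y))\<^sup>2 + (exp (- (pi * y\<^sup>2 / 2)))\<^sup>2) / 2)"
      using borel_L2_integrable[OF h] gaussian_halfwidth(2) by simp
    show "norm (norm (h y) * exp (- (pi * y\<^sup>2 / 2))) \<le> ((norm (h y))\<^sup>2 + (exp (- (pi * y\<^sup>2 / 2)))\<^sup>2) / 2" for y
      using weighted_AM_GM[of 1 "norm (h y)" "exp (- (pi * y\<^sup>2 / 2))"] by (simp add: abs_mult)
  qed measurable
  have int: "integrable (lborel \<Otimes>\<^sub>M lborel) ?\<Psi>"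
  proof (rule integrable_norm_le)
    show "integrable (lborel \<Otimes>\<^sub>M lborel) (\<lambda>(y, p). (norm (h y) * exp (- (pi * y\<^sup>2 / 2))) * (C * indicator K p))"
      by (intro lborel_product_integral(1) hg integrable_mult_right integrable_indicator_bounded K)
    have "?\<Psi> = (\<lambda>z. indicator K (snd z) *\<^sub>R (qcnj (h (fst z)) * (case z of (y, p) \<Rightarrow> inversion_integrand I f y p)))"
      by auto
    also have "\<dots> \<in> borel_measurable (lborel \<Otimes>\<^sub>M lborel)"
      by measurable
    finally show "?\<Psi> \<in> borel_measurable (lborel \<Otimes>\<^sub>M lborel)" .
    show "norm (?\<Psi> z) \<le> (\<lambda>(y, p). (norm (h y) * exp (- (pi * y\<^sup>2 / 2))) * (C * indicator K p)) z" for z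
    proof -
      obtain y p where z: "z = (y, p)" by (cases z)
      have "norm (h y) * norm (indicator K p *\<^sub>R inversion_integrand I f y p)
          \<le> norm (h y) * (C * indicator K p * exp (- (pi * y\<^sup>2 / 2)))"
        by (intro mult_left_mono C(2)) simp
      then show ?thesis
        by (simp add: z norm_mult mult_ac)
    qed
  qed
  have "(LINT y|lborel. qcnj (h y) * trunc_inv I f K y)
      = (LINT y|lborel. (2 powr (- 1/4)) *\<^sub>R (LINT p|lborel. ?\<Psi> (y, p)))"
  proof (rule Bochner_Integration.integral_cong[OF refl])
    fix y
    have "qcnj (h y) * (LINT p|lborel. indicator K p *\<^sub>R inversion_integrand I f y p)
        = (LINT p|lborel. qcnj (h y) * (indicator K p *\<^sub>R inversion_integrand I f y p))"
      by (rule Bochner_Integration.integral_mult_right[symmetric]) (rule integrable_truncated[OF I f K])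
    then show "qcnj (h y) * trunc_inv I f K y = (2 powr (- 1/4)) *\<^sub>R (LINT p|lborel. ?\<Psi> (y, p))"
      by (simp add: trunc_inv_def)
  qed
  also have "\<dots> = (2 powr (- 1/4)) *\<^sub>R (LINT y|lborel. LINT p|lborel. ?\<Psi> (y, p))"
    by (rule integral_scaleR_right)
  also have "(LINT y|lborel. LINT p|lborel. ?\<Psi> (y, p)) = (LINT p|lborel. LINT y|lborel. ?\<Psi> (y, p))"
    using lborel_pair.Fubini_integral[OF int] by simp
  also have "\<dots> = (LINT p|lborel. indicator K p *\<^sub>R (LINT y|lborel. qcnj (h y) * inversion_integrand I f y p))"
    by simp
  finally show ?thesis .
qed

lemma trunc_inv_error:
  assumes I: "I \<in> \<bbbS>" and f: "borel_L2 f" and K: "bounded K" "K \<in> sets borel"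
  shows "L2sq (\<lambda>y. f y - trunc_inv I f K y)
    \<le> sqrt 2 * (LINT p|lborel. indicator (- K) p * (case p of (x, w) \<Rightarrow> (norm (gabor I f x w))\<^sup>2))"
proof -
  define h where "h y = f y - trunc_inv I f K y" for y
  have T: "borel_L2 (trunc_inv I f K)"
    by (rule borel_L2_trunc_inv[OF I f K])
  have h: "borel_L2 h"
    unfolding h_def by (rule borel_L2_diff[OF f T])
  have nK [measurable]: "- K \<in> sets borel"
    using K(2) by auto
  define G where "G p = (case p of (x, w) \<Rightarrow> qcnj (gabor I h x w) * gabor I f x w)" for p
  define A where "A p = (case p of (x, w) \<Rightarrow> (norm (gabor I h x w))\<^sup>2)" for p
  define B where "B p = (case p of (x, w) \<Rightarrow> (norm (gabor I f x w))\<^sup>2)" for p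
  have J: "(LINT y|lborel. qcnj (h y) * inversion_integrand I f y p) = 2 powr (3/4) *\<^sub>R G p" for p
    by (cases p) (simp add: G_def inversion_integrand_inner[OF I f h])
  have G: "integrable lborel G"
    using moyal(1)[OF I h f] unfolding G_def[abs_def] by (simp add: lborel_prod)
  have A: "integrable lborel A" "integral\<^sup>L lborel A = L2sq h / sqrt 2"
    using gabor_norm[OF I h] unfolding A_def[abs_def] by (simp_all add: lborel_prod)
  have B: "integrable lborel B"
    using gabor_norm(1)[OF I f] unfolding B_def[abs_def] by (simp add: lborel_prod)
  have KG: "integrable lborel (\<lambda>p. indicator K p *\<^sub>R G p)" "integrable lborel (\<lambda>p. indicator (- K) p *\<^sub>R G p)"
    using K nK by (auto intro!: integrable_mult_indicator G)
  have KB: "integrable lborel (\<lambda>p. indicator (- K) p * B p)"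
    using integrable_mult_indicator[of "- K" lborel B] nK B by simp
  have "of_real (L2sq h) = (LINT y|lborel. qcnj (h y) * h y)"
    unfolding qcnj_mult_self L2sq_def
    by (rule integral_bounded_linear[OF bounded_linear_of_real borel_L2_integrable[OF h], symmetric])
  \<comment> \<open>Only the second factor is expanded; the first stays \<open>h\<close>, so that
    weak inversion and the truncated pairing are tested against the same function.\<close>
  also have "\<dots> = (LINT y|lborel. qcnj (h y) * f y) - (LINT y|lborel. qcnj (h y) * trunc_inv I f K y)"
    unfolding h_def right_diff_distrib unfolding h_def[symmetric]
    by (rule Bochner_Integration.integral_diff[OF integrable_L2_mult(1)[OF h f] integrable_L2_mult(1)[OF h T]])
  also have "\<dots> = sqrt 2 *\<^sub>R ((LINT p|lborel. G p) - (LINT p|lborel. indicator K p *\<^sub>R G p))"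
  proof -
    have eq: "(LINT p|lborel. indicator K p *\<^sub>R (2 powr (3/4) *\<^sub>R G p))
        = 2 powr (3/4) *\<^sub>R (LINT p|lborel. indicator K p *\<^sub>R G p)"
      unfolding scaleR_left_commute[of _ "2 powr (3/4)"] by (rule integral_scaleR_right)
    show ?thesis
      unfolding weak_inversion(2)[OF I f h] trunc_inv_inner[OF I f h K] J eq integral_scaleR_right
        two_powr_consts[symmetric]
      by (simp only: scaleR_diff_right scaleR_scaleR)
  qed
  also have "(LINT p|lborel. G p) - (LINT p|lborel. indicator K p *\<^sub>R G p)
      = (LINT p|lborel. G p - indicator K p *\<^sub>R G p)"
    by (rule Bochner_Integration.integral_diff[OF G KG(1), symmetric])
  also have "\<dots> = (LINT p|lborel. indicator (- K) p *\<^sub>R G p)"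
    by (intro Bochner_Integration.integral_cong) (auto simp: indicator_def)
  finally have "norm (of_real (L2sq h) :: quat) = norm (sqrt 2 *\<^sub>R (LINT p|lborel. indicator (- K) p *\<^sub>R G p))"
    by simp
  then have "L2sq h = sqrt 2 * norm (LINT p|lborel. indicator (- K) p *\<^sub>R G p)"
    by (simp add: L2sq_nonneg)
  also have "\<dots> \<le> sqrt 2 * (LINT p|lborel. norm (indicator (- K) p *\<^sub>R G p))"
    by (intro mult_left_mono integral_norm_bound) simp
  \<comment> \<open>The term \<open>A\<close> is kept on the whole plane, where its integral is
    \<open>L2sq h / sqrt 2\<close>. It thus contributes half of \<open>L2sq h\<close>, which the
    left side absorbs.\<close>
  also have "\<dots> \<le> sqrt 2 * (LINT p|lborel. (A p + indicator (- K) p * B p) / 2)"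
  proof (intro mult_left_mono integral_mono)
    show "integrable lborel (\<lambda>p. norm (indicator (- K) p *\<^sub>R G p))"
      by (intro integrable_norm KG)
    show "integrable lborel (\<lambda>p. (A p + indicator (- K) p * B p) / 2)"
      using A(1) KB by simp
    fix p :: "real \<times> real"
    obtain x w where p: "p = (x, w)" by (cases p)
    have "norm (gabor I h x w) * norm (gabor I f x w) \<le> ((norm (gabor I h x w))\<^sup>2 + (norm (gabor I f x w))\<^sup>2) / 2"
      using weighted_AM_GM[of 1 "norm (gabor I h x w)" "norm (gabor I f x w)"] by simp
    then show "norm (indicator (- K) p *\<^sub>R G p) \<le> (A p + indicator (- K) p * B p) / 2"
      by (simp add: p G_def A_def B_def norm_mult indicator_def)
  qed simp
  also have "\<dots> = (L2sq h + sqrt 2 * (LINT p|lborel. indicator (- K) p * B p)) / 2"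
    using A KB by (simp add: algebra_simps)
  finally have "L2sq h \<le> sqrt 2 * (LINT p|lborel. indicator (- K) p * B p)"
    by argo
  then show ?thesis
    by (simp add: h_def[abs_def] B_def)
qed

text \<open>The error bound is a tail of the integrable squared transform, which vanishes along any
  exhaustion.\<close>

lemma trunc_inv_tendsto:
  assumes I: "I \<in> \<bbbS>" and f: "borel_L2 f"
    and K: "incseq K" "\<And>n. bounded (K n)" "\<And>n. K n \<in> sets borel" "(\<Union>n. K n) = UNIV"
  shows "(\<lambda>n. L2sq (\<lambda>y. f y - trunc_inv I f (K n) y)) \<longlonglongrightarrow> 0"
proof -
  define B where "B p = (case p of (x, w) \<Rightarrow> (norm (gabor I f x w))\<^sup>2)" for p
  have B: "integrable lborel B"
    using gabor_norm(1)[OF I f] unfolding B_def[abs_def] by (simp add: lborel_prod)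
  have [measurable]: "- K n \<in> sets borel" for n
    using K(3)[of n] by auto
  have [measurable]: "B \<in> borel_measurable borel"
    using borel_measurable_integrable[OF B] by simp
  have "(\<lambda>n. LINT p|lborel. indicator (- K n) p * B p) \<longlonglongrightarrow> (LINT p::real\<times>real|lborel. (0::real))"
  proof (rule integral_dominated_convergence[OF _ _ B])
    show "AE p in lborel. (\<lambda>n. indicator (- K n) p * B p) \<longlonglongrightarrow> 0"
    proof (rule AE_I2)
      fix p
      obtain m where "p \<in> K m" using K(4) by blast
      then have "indicator (- K n) p * B p = 0" if "n \<ge> m" for n
        using incseqD[OF K(1) that] by auto
      then show "(\<lambda>n. indicator (- K n) p * B p) \<longlonglongrightarrow> 0"
        by (intro tendsto_eventually eventually_sequentiallyI)
    qed
    show "AE p in lborel. norm (indicator (- K n) p * B p) \<le> B p" for n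
      by (auto simp: indicator_def B_def split: prod.split)
  qed measurable
  then have "(\<lambda>n. sqrt 2 * (LINT p|lborel. indicator (- K n) p * B p)) \<longlonglongrightarrow> 0"
    using tendsto_mult_right_zero by fastforce
  then show ?thesis
    by (rule tendsto_sandwich[OF _ _ tendsto_const, rotated 2])
       (use trunc_inv_error[OF I f K(2,3)] L2sq_nonneg in \<open>auto simp: B_def\<close>)
qed

subsection \<open>Pointwise inversion\<close>

lemma AE_inversion:
  assumes I: "I \<in> \<bbbS>" and f: "borel_L2 f"
  shows "AE y in lborel. integrable lborel (inversion_integrand I f y) \<longrightarrow>
    f y = (2 powr (- 1/4)) *\<^sub>R (LINT p|lborel. inversion_integrand I f y p)"
proof -
  \<comment> \<open>One exhaustion, and below one subsequence, serve all \<open>y\<close> at once;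
    this is why a single null set suffices.\<close>
  define K :: "nat \<Rightarrow> (real \<times> real) set" where "K n = cball 0 (real n)" for n
  have K: "incseq K" "\<And>n. bounded (K n)" "\<And>n. K n \<in> sets borel"
    by (auto simp: K_def incseq_def)
  have K_UNIV: "(\<Union>n. K n) = UNIV"
    by (auto simp: K_def real_arch_simple)
  note [measurable] = inversion_integrand_measurable[OF I f] K(3)
  \<comment> \<open>Mean square convergence is read as L1 convergence of the squared errors, which
    supplies the almost everywhere convergent subsequence.\<close>
  have lim: "(\<lambda>n. LINT y|lborel. norm ((norm (f y - trunc_inv I f (K n) y))\<^sup>2)) \<longlonglongrightarrow> 0"
    using trunc_inv_tendsto[OF I f K K_UNIV] by (simp add: L2sq_def)
  have "integrable lborel (\<lambda>y. (norm (f y - trunc_inv I f (K n) y))\<^sup>2)" for n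
    by (intro borel_L2_integrable borel_L2_diff f borel_L2_trunc_inv I K)
  from tendsto_L1_AE_subseq[OF this lim] obtain r :: "nat \<Rightarrow> nat" where r: "strict_mono r"
    and AE: "AE y in lborel. (\<lambda>n. (norm (f y - trunc_inv I f (K (r n)) y))\<^sup>2) \<longlonglongrightarrow> 0"
    by blast
  show ?thesis
    using AE
  proof (eventually_elim, intro impI)
    fix y
    assume y: "(\<lambda>n. (norm (f y - trunc_inv I f (K (r n)) y))\<^sup>2) \<longlonglongrightarrow> 0"
      and int: "integrable lborel (inversion_integrand I f y)"
    have "(\<lambda>n. sqrt ((norm (f y - trunc_inv I f (K (r n)) y))\<^sup>2)) \<longlonglongrightarrow> sqrt 0"
      by (intro tendsto_intros y)
    then have "(\<lambda>n. f y - trunc_inv I f (K (r n)) y) \<longlonglongrightarrow> 0"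
      by (simp add: tendsto_norm_zero_iff)
    then have "(\<lambda>n. f y - (f y - trunc_inv I f (K (r n)) y)) \<longlonglongrightarrow> f y - 0"
      by (intro tendsto_diff tendsto_const)
    then have 1: "(\<lambda>n. trunc_inv I f (K (r n)) y) \<longlonglongrightarrow> f y"
      by simp
    have "(\<lambda>n. LINT p|lborel. indicator (K (r n)) p *\<^sub>R inversion_integrand I f y p)
        \<longlonglongrightarrow> (LINT p|lborel. inversion_integrand I f y p)"
    proof (rule integral_dominated_convergence)
      show "integrable lborel (\<lambda>p. norm (inversion_integrand I f y p))"
        using int by simp
      show "AE p in lborel. (\<lambda>n. indicator (K (r n)) p *\<^sub>R inversion_integrand I f y p)
          \<longlonglongrightarrow> inversion_integrand I f y p"
      proof (rule AE_I2)
        fix p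
        obtain m where m: "p \<in> K m" using K_UNIV by blast
        have "p \<in> K (r n)" if "n \<ge> m" for n
          using incseqD[OF K(1) order_trans[OF that seq_suble[OF r]]] m by blast
        then show "(\<lambda>n. indicator (K (r n)) p *\<^sub>R inversion_integrand I f y p)
            \<longlonglongrightarrow> inversion_integrand I f y p"
          by (intro tendsto_eventually eventually_sequentiallyI[of m]) simp
      qed
      show "AE p in lborel. norm (indicator (K (r n)) p *\<^sub>R inversion_integrand I f y p)
          \<le> norm (inversion_integrand I f y p)" for n
        by (auto simp: indicator_def)
    qed measurable
    then have "(\<lambda>n. trunc_inv I f (K (r n)) y) \<longlonglongrightarrow>
        (2 powr (- 1/4)) *\<^sub>R (LINT p|lborel. inversion_integrand I f y p)"
      unfolding trunc_inv_def by (intro tendsto_intros)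
    with 1 show "f y = (2 powr (- 1/4)) *\<^sub>R (LINT p|lborel. inversion_integrand I f y p)"
      by (rule LIMSEQ_unique)
  qed
qed

text \<open>Completing the square in \<open>x\<close> about the midpoint of \<open>t\<close> and
  \<open>y\<close>: the two squares sum to 2 (x - (t + y) / 2)^2 + (t - y)^2 / 2.\<close>

lemma gaussian_product_integral:
  "(LINT x|lborel. exp (- (pi * (y - x)\<^sup>2)) * exp (- (pi * (t - x)\<^sup>2)))
    = exp (- (pi * (t - y)\<^sup>2 / 2)) / sqrt 2"
proof -
  have "exp (- (pi * (y - x)\<^sup>2)) * exp (- (pi * (t - x)\<^sup>2))
      = exp (- (pi * (t - y)\<^sup>2 / 2)) * exp (- (pi * 2 * (x - (t + y) / 2)\<^sup>2))" for x
    by (simp add: power2_eq_square field_simps flip: exp_add)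
  then show ?thesis
    using has_bochner_integral_gaussian[of 2 "(t + y) / 2"] by (simp add: has_bochner_integral_iff)
qed

text \<open>Integrating over \<open>w\<close> turns the cutoff into \<open>gker n\<close>;
  integrating over \<open>x\<close> leaves the overlap of the windows at \<open>t\<close> and
  \<open>y\<close>. The constant is 2^(3/4) / sqrt 2. The integrability hypothesis lets the plane
  integral be iterated.\<close>

lemma regularised_inversion:
  assumes I: "I \<in> \<bbbS>" and f: "borel_L2 f" and int: "integrable lborel (inversion_integrand I f y)"
  shows "(LINT p|lborel. gcut n (snd p) *\<^sub>R inversion_integrand I f y p)
    = 2 powr (1/4) *\<^sub>R (LINT t|lborel. gker n (t - y) *\<^sub>R (exp (- (pi * (t - y)\<^sup>2 / 2)) *\<^sub>R f t))"
proof -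
  note [measurable] = f[THEN borel_L2_measurable]
  have m: "inversion_integrand I f y \<in> borel_measurable (lborel \<Otimes>\<^sub>M lborel)"
    using inversion_integrand_measurable[OF I f, of y] by (simp add: lborel_prod)
  have cut_int: "integrable (lborel \<Otimes>\<^sub>M lborel) (\<lambda>(x, w). gcut n w *\<^sub>R inversion_integrand I f y (x, w))"
  proof (rule integrable_norm_le)
    show "integrable (lborel \<Otimes>\<^sub>M lborel) (\<lambda>p. norm (inversion_integrand I f y p))"
      using int by (simp add: lborel_prod)
    show "(\<lambda>(x, w). gcut n w *\<^sub>R inversion_integrand I f y (x, w)) \<in> borel_measurable (lborel \<Otimes>\<^sub>M lborel)"
      using m by measurable
    show "norm (case p of (x, w) \<Rightarrow> gcut n w *\<^sub>R inversion_integrand I f y (x, w))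
        \<le> norm (inversion_integrand I f y p)" for p
      using gcut_bounds[of n "snd p"] by (cases p) (simp add: mult_left_le_one_le)
  qed
  have inner: "(LINT w|lborel. gcut n w *\<^sub>R inversion_integrand I f y (x, w))
      = (LINT t|lborel. (2 powr (3/4) * (exp (- (pi * (y - x)\<^sup>2)) * exp (- (pi * (t - x)\<^sup>2)))) *\<^sub>R
          (gker n (t - y) *\<^sub>R f t))" for x
  proof -
    have "(LINT w|lborel. gcut n w *\<^sub>R inversion_integrand I f y (x, w))
        = (LINT w|lborel. (2 powr (3/4) * exp (- (pi * (y - x)\<^sup>2))) *\<^sub>R
            (gcut n w *\<^sub>R (slice I (cis (2 * pi * w * y)) * qft I (windowed f x) w)))"
      by (simp add: inversion_integrand_eq[OF I f] gabor_def mult_ac)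
    also have "\<dots> = (2 powr (3/4) * exp (- (pi * (y - x)\<^sup>2))) *\<^sub>R (LINT t|lborel. gker n (t - y) *\<^sub>R windowed f x t)"
      by (simp only: integral_scaleR_right qft_multiplication[OF I windowed_integrable[OF f]])
    also have "\<dots> = (LINT t|lborel. (2 powr (3/4) * exp (- (pi * (y - x)\<^sup>2))) *\<^sub>R (gker n (t - y) *\<^sub>R windowed f x t))"
      by (rule integral_scaleR_right[symmetric])
    also have "\<dots> = (LINT t|lborel. (2 powr (3/4) * (exp (- (pi * (y - x)\<^sup>2)) * exp (- (pi * (t - x)\<^sup>2)))) *\<^sub>R
          (gker n (t - y) *\<^sub>R f t))"
      by (simp add: windowed_def mult_ac)
    finally show ?thesis .
  qed
  \<comment> \<open>Since \<open>f\<close> is only square integrable, square integrability of the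
    kernel is used; it holds because \<open>gker n\<close> is integrable and at most
    \<open>Suc n\<close>.\<close>
  have gf: "integrable lborel (\<lambda>t. gker n (t - y) *\<^sub>R f t)"
  proof (rule integrable_norm_le)
    show "integrable lborel (\<lambda>t. (real (Suc n) * gker n (t - y) + (norm (f t))\<^sup>2) / 2)"
      by (intro integrable_divide_zero impI Bochner_Integration.integrable_add integrable_mult_right
            integrable_gker borel_L2_integrable f)
    fix t
    have "gker n (t - y) \<le> real (Suc n)"
      unfolding gker_def by (rule mult_left_le) auto
    then have "(gker n (t - y))\<^sup>2 \<le> real (Suc n) * gker n (t - y)"
      unfolding power2_eq_square by (intro mult_right_mono) auto
    moreover have "gker n (t - y) * norm (f t) \<le> ((gker n (t - y))\<^sup>2 + (norm (f t))\<^sup>2) / 2"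
      using weighted_AM_GM[of 1 "gker n (t - y)" "norm (f t)"] by simp
    ultimately have "gker n (t - y) * norm (f t) \<le> (real (Suc n) * gker n (t - y) + (norm (f t))\<^sup>2) / 2"
      by argo
    then show "norm (gker n (t - y) *\<^sub>R f t) \<le> (real (Suc n) * gker n (t - y) + (norm (f t))\<^sup>2) / 2"
      by simp
  qed measurable
  have int2: "integrable (lborel \<Otimes>\<^sub>M lborel)
      (\<lambda>(x, t). (2 powr (3/4) * (exp (- (pi * (y - x)\<^sup>2)) * exp (- (pi * (t - x)\<^sup>2)))) *\<^sub>R (gker n (t - y) *\<^sub>R f t))"
  proof (rule integrable_norm_le)
    have "integrable lborel (\<lambda>x. 2 powr (3/4) * exp (- (pi * (y - x)\<^sup>2)))"
      using gaussian_window(1)[of y] by (simp add: power2_commute[of y])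
    then show "integrable (lborel \<Otimes>\<^sub>M lborel)
        (\<lambda>(x, t). (2 powr (3/4) * exp (- (pi * (y - x)\<^sup>2))) * norm (gker n (t - y) *\<^sub>R f t))"
      by (intro lborel_product_integral(1) integrable_norm gf)
    show "norm ((\<lambda>(x, t). (2 powr (3/4) * (exp (- (pi * (y - x)\<^sup>2)) * exp (- (pi * (t - x)\<^sup>2)))) *\<^sub>R (gker n (t - y) *\<^sub>R f t)) p)
        \<le> (\<lambda>(x, t). (2 powr (3/4) * exp (- (pi * (y - x)\<^sup>2))) * norm (gker n (t - y) *\<^sub>R f t)) p" for p
      by (cases p) (simp add: mult_left_mono mult_right_mono mult_left_le_one_le)
  qed measurable
  have "(LINT p|lborel. gcut n (snd p) *\<^sub>R inversion_integrand I f y p)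
      = (LINT x|lborel. LINT w|lborel. gcut n w *\<^sub>R inversion_integrand I f y (x, w))"
    using lborel_pair.integral_fst[OF cut_int] by (simp add: lborel_prod case_prod_unfold)
  also have "\<dots> = (LINT t|lborel. LINT x|lborel. (2 powr (3/4) * (exp (- (pi * (y - x)\<^sup>2)) * exp (- (pi * (t - x)\<^sup>2)))) *\<^sub>R
          (gker n (t - y) *\<^sub>R f t))"
    unfolding inner by (rule lborel_pair.Fubini_integral[OF int2, symmetric])
  also have "\<dots> = (LINT t|lborel. 2 powr (1/4) *\<^sub>R (gker n (t - y) *\<^sub>R (exp (- (pi * (t - y)\<^sup>2 / 2)) *\<^sub>R f t)))"
  proof (rule Bochner_Integration.integral_cong[OF refl])
    fix t
    have *: "integrable lborel (\<lambda>x. 2 powr (3/4) * (exp (- (pi * (y - x)\<^sup>2)) * exp (- (pi * (t - x)\<^sup>2))))"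
    proof (rule integrable_norm_le)
      show "integrable lborel (\<lambda>x. 2 powr (3/4) * exp (- (pi * (y - x)\<^sup>2)))"
        using gaussian_window(1)[of y] by (simp add: power2_commute[of y])
    qed (auto simp: abs_mult mult_left_le)
    have "2 powr (3/4) = 2 powr (1/4) * sqrt (2::real)"
      by (simp add: powr_half_sqrt[symmetric] flip: powr_add)
    then have eq: "(LINT x|lborel. 2 powr (3/4) * (exp (- (pi * (y - x)\<^sup>2)) * exp (- (pi * (t - x)\<^sup>2))))
        = 2 powr (1/4) * exp (- (pi * (t - y)\<^sup>2 / 2))"
      by (simp only: integral_mult_right_zero gaussian_product_integral) simp
    show "(LINT x|lborel. (2 powr (3/4) * (exp (- (pi * (y - x)\<^sup>2)) * exp (- (pi * (t - x)\<^sup>2)))) *\<^sub>R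
          (gker n (t - y) *\<^sub>R f t)) = 2 powr (1/4) *\<^sub>R (gker n (t - y) *\<^sub>R (exp (- (pi * (t - y)\<^sup>2 / 2)) *\<^sub>R f t))"
      unfolding integral_scaleR_left[OF *] eq by (simp only: scaleR_scaleR mult_ac)
  qed
  also have "\<dots> = 2 powr (1/4) *\<^sub>R (LINT t|lborel. gker n (t - y) *\<^sub>R (exp (- (pi * (t - y)\<^sup>2 / 2)) *\<^sub>R f t))"
    by (rule integral_scaleR_right)
  finally show ?thesis .
qed

text \<open>The regularised integrals have two limits: dominated convergence removes the cutoff, and
  the approximate identity localises at \<open>y\<close>. The limit \<open>L\<close> is an essential
  one because a Borel representative may take another value at \<open>y\<close> itself.\<close>

lemma pointwise_inversion:
  assumes I: "I \<in> \<bbbS>" and f: "borel_L2 f" and int: "integrable lborel (inversion_integrand I f y)"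
    and lim: "\<And>e. e > 0 \<Longrightarrow> \<exists>d>0. AE t in lborel. \<bar>t - y\<bar> < d \<longrightarrow> norm (f t - L) \<le> e"
  shows "L = (2 powr (- 1/4)) *\<^sub>R (LINT p|lborel. inversion_integrand I f y p)"
proof -
  note [measurable] = f[THEN borel_L2_measurable] inversion_integrand_measurable[OF I f]
  \<comment> \<open>The normalised window overlap. It is continuous with value 1 at
    \<open>y\<close>, so multiplying by it does not change the essential limit there.\<close>
  define v where "v t = exp (- (pi * (t - y)\<^sup>2 / 2))" for t
  have v: "0 \<le> v t" "v t \<le> 1" for t
    by (simp_all add: v_def)
  have [measurable]: "v \<in> borel_measurable borel"
    by (simp add: v_def[abs_def])
  have 1: "(\<lambda>n. LINT p|lborel. gcut n (snd p) *\<^sub>R inversion_integrand I f y p)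
      \<longlonglongrightarrow> (LINT p|lborel. inversion_integrand I f y p)"
  proof (rule integral_dominated_convergence)
    show "integrable lborel (\<lambda>p. norm (inversion_integrand I f y p))"
      using int by simp
    have "(\<lambda>n. gcut n (snd p) *\<^sub>R inversion_integrand I f y p) \<longlonglongrightarrow> 1 *\<^sub>R inversion_integrand I f y p" for p
      by (intro tendsto_scaleR gcut_tendsto tendsto_const)
    then show "AE p in lborel. (\<lambda>n. gcut n (snd p) *\<^sub>R inversion_integrand I f y p)
        \<longlonglongrightarrow> inversion_integrand I f y p"
      by (intro AE_I2) (simp only: scaleR_one)
    show "AE p in lborel. norm (gcut n (snd p) *\<^sub>R inversion_integrand I f y p)
        \<le> norm (inversion_integrand I f y p)" for n
      using gcut_bounds by (intro AE_I2) (simp add: mult_left_le_one_le)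
    show "(\<lambda>p. gcut n (snd p) *\<^sub>R inversion_integrand I f y p) \<in> borel_measurable lborel" for n
      unfolding lborel_prod[symmetric]
      using inversion_integrand_measurable[OF I f, of y]
      by (intro borel_measurable_scaleR measurable_compose[OF measurable_snd])
         (simp_all add: lborel_prod)
  qed measurable
  have 2: "(\<lambda>n. LINT t|lborel. gker n (t - y) *\<^sub>R (v t *\<^sub>R f t)) \<longlonglongrightarrow> L"
  proof (rule gker_approx_identity)
    show "integrable lborel (\<lambda>t. exp (- (pi * (t - y)\<^sup>2)) *\<^sub>R (v t *\<^sub>R f t))"
    proof (rule integrable_norm_le)
      show "integrable lborel (\<lambda>t. norm (windowed f y t))"
        by (intro integrable_norm windowed_integrable f)
      show "norm (exp (- (pi * (t - y)\<^sup>2)) *\<^sub>R (v t *\<^sub>R f t)) \<le> norm (windowed f y t)" for t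
        using v[of t] by (simp add: windowed_def mult_left_le_one_le)
    qed measurable
    fix e :: real assume e: "e > 0"
    obtain d1 where d1: "d1 > 0" "AE t in lborel. \<bar>t - y\<bar> < d1 \<longrightarrow> norm (f t - L) \<le> e / 2"
      using lim[of "e / 2"] e by auto
    have "isCont v y"
      by (simp add: v_def[abs_def])
    then have "isCont (\<lambda>t. (v t - 1) *\<^sub>R L) y"
      by (intro continuous_intros)
    then obtain d2 where d2: "d2 > 0" "\<And>t. dist t y < d2 \<Longrightarrow> dist ((v t - 1) *\<^sub>R L) ((v y - 1) *\<^sub>R L) < e / 2"
      unfolding continuous_at_eps_delta using e by (meson half_gt_zero)
    have "AE t in lborel. \<bar>t - y\<bar> < min d1 d2 \<longrightarrow> norm (v t *\<^sub>R f t - L) \<le> e"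
      using d1(2)
    proof (eventually_elim, intro impI)
      fix t assume t: "\<bar>t - y\<bar> < d1 \<longrightarrow> norm (f t - L) \<le> e / 2" "\<bar>t - y\<bar> < min d1 d2"
      have "v t *\<^sub>R f t - L = v t *\<^sub>R (f t - L) + (v t - 1) *\<^sub>R L"
        by (simp add: algebra_simps scaleR_diff_left)
      then have "norm (v t *\<^sub>R f t - L) \<le> norm (v t *\<^sub>R (f t - L)) + norm ((v t - 1) *\<^sub>R L)"
        by (metis norm_triangle_ineq)
      also have "norm (v t *\<^sub>R (f t - L)) \<le> norm (f t - L)"
        using v[of t] by (simp add: mult_left_le_one_le)
      also have "norm (f t - L) \<le> e / 2"
        using t by simp
      also have "norm ((v t - 1) *\<^sub>R L) \<le> e / 2"
        using d2(2)[of t] t by (simp add: dist_norm v_def[of y])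
      finally show "norm (v t *\<^sub>R f t - L) \<le> e"
        by simp
    qed
    then show "\<exists>d>0. AE t in lborel. \<bar>t - y\<bar> < d \<longrightarrow> norm (v t *\<^sub>R f t - L) \<le> e"
      using d1(1) d2(1) by (intro exI[of _ "min d1 d2"]) simp
  qed measurable
  have "(\<lambda>n. LINT p|lborel. gcut n (snd p) *\<^sub>R inversion_integrand I f y p) \<longlonglongrightarrow> 2 powr (1/4) *\<^sub>R L"
    unfolding regularised_inversion[OF I f int] v_def[symmetric] by (intro tendsto_intros 2)
  then have "(LINT p|lborel. inversion_integrand I f y p) = 2 powr (1/4) *\<^sub>R L"
    using 1 LIMSEQ_unique by blast
  then show ?thesis
    by (simp flip: powr_add)
qed

subsection \<open>Passage to Borel representatives\<close>

lemma L2_quat_borel_representative: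
  assumes f: "f \<in> L2_quat"
  obtains g where "borel_L2 g" "AE t in lebesgue. f t = g t"
proof -
  have m: "f \<in> borel_measurable lebesgue" and int: "integrable lebesgue (\<lambda>t. (norm (f t))\<^sup>2)"
    using f by (auto simp: L2_quat_def)
  obtain g where g: "g \<in> borel_measurable lborel" "AE t in lborel. f t = g t"
    using completion_ex_borel_measurable_euclidean[OF m] by blast
  have AE: "AE t in lebesgue. f t = g t"
    using g(2) by (simp add: AE_completion)
  have [measurable]: "g \<in> borel_measurable borel" "g \<in> borel_measurable lebesgue"
    using g(1) by (simp_all add: measurable_completion)
  note [measurable] = m
  have "integrable lebesgue (\<lambda>t. (norm (g t))\<^sup>2)"
    using AE by (intro integrable_cong_AE_imp[OF int]) (measurable, auto)
  then have "integrable lborel (\<lambda>t. (norm (g t))\<^sup>2)"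
    by (subst (asm) integrable_completion) auto
  then have "borel_L2 g"
    by (simp add: borel_L2_def)
  then show ?thesis
    using AE by (rule that)
qed

lemma borel_L2_imp_L2_quat: "borel_L2 f \<Longrightarrow> f \<in> L2_quat"
  by (auto simp: borel_L2_def L2_quat_def integrable_completion measurable_completion)

lemma L2_norm_eq:
  assumes "borel_L2 f"
  shows "L2_norm f = sqrt (L2sq f)"
proof -
  have [measurable]: "f \<in> borel_measurable borel"
    by (rule borel_L2_measurable[OF assms])
  have "(LINT t|lebesgue. (norm (f t))\<^sup>2) = (LINT t|lborel. (norm (f t))\<^sup>2)"
    by (rule integral_completion) measurable
  then show ?thesis
    by (simp add: L2_norm_def L2sq_def)
qed

text \<open>The signal enters only through an integral, so the integrands agree at every point.
  Integrability conditions at an individual \<open>y\<close> therefore pass to the representative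
  unchanged.\<close>

lemma inversion_integrand_cong:
  assumes I: "I \<in> \<bbbS>" and f: "f \<in> L2_quat" and g: "borel_L2 g" and AE: "AE t in lebesgue. f t = g t"
  shows "inversion_integrand I f = inversion_integrand I g"
proof -
  have [measurable]: "f \<in> borel_measurable lebesgue" "g \<in> borel_measurable lebesgue"
    using f g by (auto simp: L2_quat_def borel_L2_def measurable_completion)
  have B: "segal_bargmann f (slice I z) = segal_bargmann g (slice I z)" for z
  proof -
    have "(\<lambda>t. slice I (exp (- pi *\<^sub>R (z\<^sup>2 + complex_of_real (t\<^sup>2)) + (2 * pi * sqrt 2 * t) *\<^sub>R z)))
        \<in> borel_measurable borel"
      by measurable
    then have [measurable]: "(\<lambda>t. slice I (exp (- pi *\<^sub>R (z\<^sup>2 + complex_of_real (t\<^sup>2)) + (2 * pi * sqrt 2 * t) *\<^sub>R z)))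
        \<in> borel_measurable lebesgue"
      by (simp add: measurable_completion)
    show ?thesis
      unfolding segal_bargmann_def segal_bargmann_kernel_slice[OF I]
    proof (rule integral_cong_AE)
      show "AE t in lebesgue. (2 powr (3/4)) *\<^sub>R
          slice I (exp (- pi *\<^sub>R (z\<^sup>2 + complex_of_real (t\<^sup>2)) + (2 * pi * sqrt 2 * t) *\<^sub>R z)) * f t
        = (2 powr (3/4)) *\<^sub>R
          slice I (exp (- pi *\<^sub>R (z\<^sup>2 + complex_of_real (t\<^sup>2)) + (2 * pi * sqrt 2 * t) *\<^sub>R z)) * g t"
        using AE by eventually_elim simp
    qed measurable
  qed
  have "QSTFT I f x w = QSTFT I g x w" for x w
    by (simp only: QSTFT_def Let_def qcnj_slice_point[OF I] B)
  then show ?thesis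
    by (simp add: inversion_integrand_def fun_eq_iff)
qed

lemma L2_inner_eq:
  assumes h: "h \<in> L2_quat" and k: "borel_L2 k" and AE: "AE t in lebesgue. h t = k t"
    and u: "u \<in> borel_measurable lebesgue" and v: "v \<in> borel_measurable borel"
    and AE': "AE t in lebesgue. u t = v t"
  shows "L2_inner u h = (LINT t|lborel. qcnj (k t) * v t)"
proof -
  have [measurable]: "h \<in> borel_measurable lebesgue" "k \<in> borel_measurable borel" "v \<in> borel_measurable borel"
    using h k v by (auto simp: L2_quat_def borel_L2_def)
  note [measurable] = u
  have [measurable]: "k \<in> borel_measurable lebesgue" "v \<in> borel_measurable lebesgue"
    by (simp_all add: measurable_completion)
  have "L2_inner u h = (LINT t|lebesgue. qcnj (k t) * v t)"
    unfolding L2_inner_def using AE AE' by (intro integral_cong_AE) (measurable, auto)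
  also have "\<dots> = (LINT t|lborel. qcnj (k t) * v t)"
    by (rule integral_completion) measurable
  finally show ?thesis .
qed

text \<open>The double integral can fail to converge absolutely: for the indicator of an interval
  the transform decays only like 1 / |w|. Also, changing \<open>f\<close> on a null set leaves the
  integral unchanged. The formula is therefore given four meanings: as an L2 limit along every
  exhaustion by bounded Borel sets, weakly against each \<open>h\<close>, almost everywhere among
  points where the integrand is integrable, and at every such point where \<open>f\<close> is
  continuous.\<close>

theorem theorem5p8:
  fixes I :: quat and f :: "real \<Rightarrow> quat"
  assumes I: "I \<in> \<bbbS>" and f: "f \<in> L2_quat"
  shows
    "(\<forall>K :: nat \<Rightarrow> (real \<times> real) set.
        incseq K \<and> (\<forall>n. bounded (K n) \<and> K n \<in> sets borel) \<and> (\<Union>n. K n) = UNIV \<longrightarrow>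
          (\<forall>n y. set_integrable lebesgue (K n) (inversion_integrand I f y)) \<and>
          (\<forall>n. inversion_over I f (K n) \<in> L2_quat) \<and>
          (\<lambda>n. L2_norm (\<lambda>y. f y - inversion_over I f (K n) y)) \<longlonglongrightarrow> 0) \<and>
     (\<forall>h\<in>L2_quat.
        integrable lebesgue (\<lambda>p. L2_inner (\<lambda>y. inversion_integrand I f y p) h) \<and>
        L2_inner f h =
          (2 powr (- 1/4)) *\<^sub>R (LINT p|lebesgue. L2_inner (\<lambda>y. inversion_integrand I f y p) h)) \<and>
     (AE y in lebesgue. integrable lebesgue (inversion_integrand I f y) \<longrightarrow>
        f y = (2 powr (- 1/4)) *\<^sub>R (LINT p|lebesgue. inversion_integrand I f y p)) \<and>
     (\<forall>y. integrable lebesgue (inversion_integrand I f y) \<and> isCont f y \<longrightarrow>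
        f y = (2 powr (- 1/4)) *\<^sub>R (LINT p|lebesgue. inversion_integrand I f y p))"
proof -
  obtain g where g: "borel_L2 g" and AE: "AE t in lebesgue. f t = g t"
    using L2_quat_borel_representative[OF f] by blast
  have J: "inversion_integrand I f = inversion_integrand I g"
    by (rule inversion_integrand_cong[OF I f g AE])
  then have over: "inversion_over I f = inversion_over I g"
    by (intro ext) (simp only: inversion_over_def)
  have f_meas: "f \<in> borel_measurable lebesgue"
    using f by (simp add: L2_quat_def)
  note Jm = inversion_integrand_measurable[OF I g]
  have J_int: "integrable lebesgue (inversion_integrand I g y) \<longleftrightarrow> integrable lborel (inversion_integrand I g y)" for y
    using Jm by (intro integrable_completion) simp
  have J_LINT: "(LINT p|lebesgue. inversion_integrand I g y p) = (LINT p|lborel. inversion_integrand I g y p)" for y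
    using Jm by (intro integral_completion) simp
  have part1: "(\<forall>n y. set_integrable lebesgue (K n) (inversion_integrand I f y)) \<and>
          (\<forall>n. inversion_over I f (K n) \<in> L2_quat) \<and>
          (\<lambda>n. L2_norm (\<lambda>y. f y - inversion_over I f (K n) y)) \<longlonglongrightarrow> 0"
    if "incseq K \<and> (\<forall>n. bounded (K n) \<and> K n \<in> sets borel) \<and> (\<Union>n. K n) = UNIV"
    for K :: "nat \<Rightarrow> (real \<times> real) set"
  proof -
    have K: "incseq K" "\<And>n. bounded (K n)" "\<And>n. K n \<in> sets borel" "(\<Union>n. K n) = UNIV"
      using that by auto
    have over_g: "inversion_over I f (K n) = trunc_inv I g (K n)" for n
      unfolding over by (rule ext) (rule inversion_over_eq[OF I g K(3)])
    have T: "borel_L2 (trunc_inv I g (K n))" for n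
      by (rule borel_L2_trunc_inv[OF I g K(2,3)])
    have "set_integrable lebesgue (K n) (inversion_integrand I f y)" for n y
      unfolding J set_integrable_def
      using integrable_truncated[OF I g K(2,3)] Jm K(3)
      by (subst integrable_completion) auto
    moreover have "inversion_over I f (K n) \<in> L2_quat" for n
      unfolding over_g by (rule borel_L2_imp_L2_quat[OF T])
    moreover have "L2_norm (\<lambda>y. f y - inversion_over I f (K n) y) = sqrt (L2sq (\<lambda>y. g y - trunc_inv I g (K n) y))" for n
    proof -
      have [measurable]: "g \<in> borel_measurable lebesgue" "trunc_inv I g (K n) \<in> borel_measurable lebesgue"
        using g T[of n] by (simp_all add: borel_L2_def measurable_completion)
      note [measurable] = f_meas
      have "L2_norm (\<lambda>y. f y - inversion_over I f (K n) y) = L2_norm (\<lambda>y. g y - trunc_inv I g (K n) y)"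
        unfolding L2_norm_def over_g
        using AE by (intro arg_cong[where f = sqrt] integral_cong_AE) (measurable, auto)
      then show ?thesis
        by (simp add: L2_norm_eq borel_L2_diff g T)
    qed
    moreover have "(\<lambda>n. sqrt (L2sq (\<lambda>y. g y - trunc_inv I g (K n) y))) \<longlonglongrightarrow> sqrt 0"
      by (intro tendsto_intros trunc_inv_tendsto[OF I g K])
    ultimately show ?thesis
      by simp
  qed
  have part2: "integrable lebesgue (\<lambda>p. L2_inner (\<lambda>y. inversion_integrand I f y p) h) \<and>
        L2_inner f h =
          (2 powr (- 1/4)) *\<^sub>R (LINT p|lebesgue. L2_inner (\<lambda>y. inversion_integrand I f y p) h)"
    if h: "h \<in> L2_quat" for h
  proof -
    obtain k where k: "borel_L2 k" and AE_h: "AE t in lebesgue. h t = k t"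
      using L2_quat_borel_representative[OF h] by blast
    have "(\<lambda>y. inversion_integrand I g y p) \<in> borel_measurable borel" for p
      using measurable_compose[OF measurable_Pair2' inversion_integrand_measurable2[OF I g], of p]
      by simp
    then have J_inner: "L2_inner (\<lambda>y. inversion_integrand I f y p) h
        = (LINT y|lborel. qcnj (k y) * inversion_integrand I g y p)" for p
      unfolding J by (intro L2_inner_eq[OF h k AE_h]) (auto simp: measurable_completion)
    have f_inner: "L2_inner f h = (LINT y|lborel. qcnj (k y) * g y)"
      by (rule L2_inner_eq[OF h k AE_h f_meas borel_L2_measurable[OF g] AE])
    note W = weak_inversion[OF I g k]
    have m: "(\<lambda>p. LINT y|lborel. qcnj (k y) * inversion_integrand I g y p) \<in> borel_measurable lborel"
      by (rule borel_measurable_integrable[OF W(1)])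
    show ?thesis
      unfolding J_inner f_inner integrable_completion[OF m] integral_completion[OF m]
      using W by blast
  qed
  have part3: "AE y in lebesgue. integrable lebesgue (inversion_integrand I f y) \<longrightarrow>
        f y = (2 powr (- 1/4)) *\<^sub>R (LINT p|lebesgue. inversion_integrand I f y p)"
    using AE AE_completion[OF AE_inversion[OF I g]]
    unfolding J J_int J_LINT by eventually_elim simp
  have part4: "f y = (2 powr (- 1/4)) *\<^sub>R (LINT p|lebesgue. inversion_integrand I f y p)"
    if y: "integrable lebesgue (inversion_integrand I f y)" "isCont f y" for y
    unfolding J J_LINT
  \<comment> \<open>Continuity is known for \<open>f\<close>, not for the representative
    \<open>g\<close>; it reaches \<open>g\<close> only almost everywhere near \<open>y\<close>, with
    essential limit \<open>f y\<close>.\<close>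
  proof (rule pointwise_inversion[OF I g])
    show "integrable lborel (inversion_integrand I g y)"
      using y(1) by (simp add: J J_int)
    fix e :: real assume "e > 0"
    with y(2) obtain d where d: "d > 0" "\<And>t. dist t y < d \<Longrightarrow> dist (f t) (f y) < e"
      unfolding continuous_at_eps_delta by blast
    have "AE t in lborel. f t = g t"
      using AE by (simp add: AE_completion_iff)
    then have "AE t in lborel. \<bar>t - y\<bar> < d \<longrightarrow> norm (g t - f y) \<le> e"
    proof (eventually_elim, intro impI)
      fix t assume "f t = g t" "\<bar>t - y\<bar> < d"
      then show "norm (g t - f y) \<le> e"
        using d(2)[of t] by (simp add: dist_norm)
    qed
    with d(1) show "\<exists>d>0. AE t in lborel. \<bar>t - y\<bar> < d \<longrightarrow> norm (g t - f y) \<le> e"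
      by blast
  qed
  show ?thesis
    by (rule conjI[OF _ conjI[OF _ conjI[OF part3]]]; intro allI impI ballI;
        (erule part1 | erule part2 | (erule conjE, erule part4, assumption)))
qed

end
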